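(* There exist $\omega_0>0$, $C>0$ and a real-analytic map $(\omega_0,\infty)\ni\omega\mapsto \phi_\omega\in l^2_{10}$ such that for every $\omega\in(\omega_0,\infty)$ $$0=-\Delta_{\mathrm d}\phi_\omega+\omega\phi_\omega-|\phi_\omega|^6\phi_\omega ,$$ $$\sum_{j=0}^2\omega^j\left\|\partial_\omega^j\phi_\omega-\partial_\omega^j\left(\omega^{1/6}\delta_0\right)\right\|_{l^2_{10}}\le C\omega^{-5/6},$$ and $$\sum_{j=0}^2\omega^j\left\|P_0^\perp\partial_\omega^j\phi_\omega\right\|_{l^2_{10}}\le C\omega^{-5/6}.$$
   Context: For $u:\mathbb Z\to\mathbb C$, the discrete Laplacian is $\Delta_{\mathrm d}u(x)=u(x+1)-2u(x)+u(x-1)$. For $a\in\mathbb R$, $\|u\|_{l^p_a}:=\|e^{a|\cdot|}u\|_{l^p(\mathbb Z)}$, and $l^p_a$ is the space of $u:\mathbb Z\to\mathbb C$ with finite norm. $\delta_0:\mathbb Z\to\mathbb R$ is $\delta_0(0)=1$, $\delta_0(x)=0$ for $x\ne0$. $P_0^\perp u:=u-u(0)\delta_0$, i.e. $P_0^\perp$ sets the value at $x=0$ to zero. *)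

theory Defs
  imports "HOL-Analysis.Analysis"
begin

definition discrete_laplacian :: "(int \<Rightarrow> complex) \<Rightarrow> int \<Rightarrow> complex"
  where "discrete_laplacian u x = u (x + 1) - 2 * u x + u (x - 1)"

definition delta0 :: "int \<Rightarrow> real"
  where "delta0 x = (if x = 0 then 1 else 0)"

definition P0_perp :: "(int \<Rightarrow> complex) \<Rightarrow> int \<Rightarrow> complex"
  where "P0_perp u x = u x - u 0 * complex_of_real (delta0 x)"

definition weighted_l2 :: "real \<Rightarrow> (int \<Rightarrow> complex) set"
  where "weighted_l2 a =
    {u. (\<lambda>x. (cmod (complex_of_real (exp (a * real_of_int \<bar>x\<bar>)) * u x))\<^sup>2) summable_on UNIV}"

text \<open>Since \<open>infsum\<close> is 0 for non-summable families, this is only meaningful on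
  \<open>weighted_l2 a\<close>.\<close>

definition weighted_l2_norm :: "real \<Rightarrow> (int \<Rightarrow> complex) \<Rightarrow> real"
  where "weighted_l2_norm a u =
    sqrt (\<Sum>\<^sub>\<infinity>x. (cmod (complex_of_real (exp (a * real_of_int \<bar>x\<bar>)) * u x))\<^sup>2)"

lemma weighted_l2_zero: "(\<lambda>x. 0) \<in> weighted_l2 a"
  by (simp add: weighted_l2_def)

lemma weighted_l2_finite_support:
  assumes "finite {x. u x \<noteq> 0}"
  shows "u \<in> weighted_l2 a"
proof -
  have "(\<lambda>x. (cmod (complex_of_real (exp (a * real_of_int \<bar>x\<bar>)) * u x))\<^sup>2) summable_on {x. u x \<noteq> 0}"
    using assms by simp
  then show ?thesis
    unfolding weighted_l2_def mem_Collect_eq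
    by (rule summable_on_cong_neutral[THEN iffD1, rotated -1]) auto
qed

lemma weighted_l2_norm_nonneg: "0 \<le> weighted_l2_norm a u"
  by (simp add: weighted_l2_norm_def infsum_nonneg)

lemma L2_set_le_weighted_l2_norm:
  assumes "u \<in> weighted_l2 a" "finite F"
  shows "L2_set (\<lambda>x. cmod (complex_of_real (exp (a * real_of_int \<bar>x\<bar>)) * u x)) F \<le> weighted_l2_norm a u"
  using assms
  unfolding weighted_l2_def weighted_l2_norm_def L2_set_def mem_Collect_eq
  by (intro real_sqrt_le_mono finite_sum_le_infsum) auto

lemma weighted_l2_add_aux:
  assumes u: "u \<in> weighted_l2 a" and v: "v \<in> weighted_l2 a" and F: "finite F"
  shows "(\<Sum>x\<in>F. (cmod (complex_of_real (exp (a * real_of_int \<bar>x\<bar>)) * (u x + v x)))\<^sup>2)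
    \<le> (weighted_l2_norm a u + weighted_l2_norm a v)\<^sup>2"
proof -
  let ?w = "\<lambda>x. complex_of_real (exp (a * real_of_int \<bar>x\<bar>))"
  have "L2_set (\<lambda>x. cmod (?w x * (u x + v x))) F
      \<le> L2_set (\<lambda>x. cmod (?w x * u x) + cmod (?w x * v x)) F"
    by (rule L2_set_mono) (auto simp: distrib_left norm_triangle_ineq)
  also have "\<dots> \<le> L2_set (\<lambda>x. cmod (?w x * u x)) F + L2_set (\<lambda>x. cmod (?w x * v x)) F"
    by (rule L2_set_triangle_ineq)
  also have "\<dots> \<le> weighted_l2_norm a u + weighted_l2_norm a v"
    using L2_set_le_weighted_l2_norm[OF u F] L2_set_le_weighted_l2_norm[OF v F] by simp
  finally have "sqrt (\<Sum>x\<in>F. (cmod (?w x * (u x + v x)))\<^sup>2)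
      \<le> weighted_l2_norm a u + weighted_l2_norm a v"
    by (simp add: L2_set_def)
  then show ?thesis
    using sqrt_le_D by blast
qed

lemma weighted_l2_add:
  assumes u: "u \<in> weighted_l2 a" and v: "v \<in> weighted_l2 a"
  shows "(\<lambda>x. u x + v x) \<in> weighted_l2 a"
  unfolding weighted_l2_def mem_Collect_eq
proof (rule nonneg_bdd_above_summable_on)
  show "bdd_above (sum (\<lambda>x. (cmod (complex_of_real (exp (a * real_of_int \<bar>x\<bar>)) * (u x + v x)))\<^sup>2)
      ` {F. F \<subseteq> UNIV \<and> finite F})"
    by (rule bdd_aboveI2[where M = "(weighted_l2_norm a u + weighted_l2_norm a v)\<^sup>2"])
      (use weighted_l2_add_aux[OF u v] in blast)
qed simp

lemma weighted_l2_norm_triangle: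
  assumes u: "u \<in> weighted_l2 a" and v: "v \<in> weighted_l2 a"
  shows "weighted_l2_norm a (\<lambda>x. u x + v x) \<le> weighted_l2_norm a u + weighted_l2_norm a v"
proof -
  have "(\<Sum>\<^sub>\<infinity>x. (cmod (complex_of_real (exp (a * real_of_int \<bar>x\<bar>)) * (u x + v x)))\<^sup>2)
      \<le> (weighted_l2_norm a u + weighted_l2_norm a v)\<^sup>2"
    using weighted_l2_add[OF u v] weighted_l2_add_aux[OF u v]
    by (intro infsum_le_finite_sums) (auto simp: weighted_l2_def)
  then have "sqrt (\<Sum>\<^sub>\<infinity>x. (cmod (complex_of_real (exp (a * real_of_int \<bar>x\<bar>)) * (u x + v x)))\<^sup>2)
      \<le> weighted_l2_norm a u + weighted_l2_norm a v"
    by (intro real_le_lsqrt) (auto simp: weighted_l2_norm_nonneg infsum_nonneg)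
  then show ?thesis
    by (simp only: weighted_l2_norm_def)
qed

lemma weighted_l2_mult:
  assumes "u \<in> weighted_l2 a"
  shows "(\<lambda>x. c * u x) \<in> weighted_l2 a"
proof -
  have "(\<lambda>x. (cmod c)\<^sup>2 * (cmod (complex_of_real (exp (a * real_of_int \<bar>x\<bar>)) * u x))\<^sup>2) summable_on UNIV"
    using assms by (intro summable_on_cmult_right) (simp add: weighted_l2_def)
  then show ?thesis
    by (simp add: weighted_l2_def norm_mult power_mult_distrib mult.left_commute)
qed

lemma weighted_l2_norm_mult:
  "weighted_l2_norm a (\<lambda>x. c * u x) = cmod c * weighted_l2_norm a u"
proof -
  have "(\<Sum>\<^sub>\<infinity>x. (cmod (complex_of_real (exp (a * real_of_int \<bar>x\<bar>)) * (c * u x)))\<^sup>2)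
      = (\<Sum>\<^sub>\<infinity>x. (cmod c)\<^sup>2 * (cmod (complex_of_real (exp (a * real_of_int \<bar>x\<bar>)) * u x))\<^sup>2)"
    by (simp add: norm_mult power_mult_distrib mult.left_commute)
  also have "\<dots> = (cmod c)\<^sup>2 * (\<Sum>\<^sub>\<infinity>x. (cmod (complex_of_real (exp (a * real_of_int \<bar>x\<bar>)) * u x))\<^sup>2)"
    by (rule infsum_cmult_right')
  finally show ?thesis
    by (simp add: weighted_l2_norm_def real_sqrt_mult)
qed

lemma weighted_l2_norm_eq_0:
  assumes "u \<in> weighted_l2 a"
  shows "weighted_l2_norm a u = 0 \<longleftrightarrow> u = (\<lambda>x. 0)"
proof
  assume z: "weighted_l2_norm a u = 0"
  show "u = (\<lambda>x. 0)"
  proof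
    fix x
    have "L2_set (\<lambda>x. cmod (complex_of_real (exp (a * real_of_int \<bar>x\<bar>)) * u x)) {x} \<le> 0"
      using L2_set_le_weighted_l2_norm[OF assms, of "{x}"] z by simp
    then show "u x = 0"
      by (simp add: L2_set_def)
  qed
qed (simp add: weighted_l2_norm_def)

lemma P0_perp_weighted_l2:
  assumes "u \<in> weighted_l2 a"
  shows "P0_perp u \<in> weighted_l2 a"
proof -
  have "(\<lambda>x. - u 0 * complex_of_real (delta0 x)) \<in> weighted_l2 a"
    by (rule weighted_l2_finite_support, rule finite_subset[of _ "{0}"])
      (auto simp: delta0_def)
  from weighted_l2_add[OF assms this] show ?thesis
    by (simp add: P0_perp_def[abs_def])
qed


text \<open>The space \<open>weighted_l2 10\<close> as a type, so that the library's norm, limits, series and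
  derivatives (all with respect to \<open>weighted_l2_norm 10\<close>) are available for maps into it.\<close>

typedef l2_10 = "weighted_l2 10"
  morphisms l2_10_apply Abs_l2_10
  using weighted_l2_zero by blast

setup_lifting type_definition_l2_10

instantiation l2_10 :: real_normed_vector
begin

lift_definition norm_l2_10 :: "l2_10 \<Rightarrow> real" is "weighted_l2_norm 10" .

lift_definition zero_l2_10 :: l2_10 is "\<lambda>x. 0"
  by (rule weighted_l2_zero)

lift_definition plus_l2_10 :: "l2_10 \<Rightarrow> l2_10 \<Rightarrow> l2_10" is "\<lambda>u v x. u x + v x"
  by (rule weighted_l2_add)

lift_definition uminus_l2_10 :: "l2_10 \<Rightarrow> l2_10" is "\<lambda>u x. - u x"
  using weighted_l2_mult[of _ 10 "-1"] by simp

lift_definition minus_l2_10 :: "l2_10 \<Rightarrow> l2_10 \<Rightarrow> l2_10" is "\<lambda>u v x. u x - v x"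
  using weighted_l2_add[OF _ weighted_l2_mult[of _ 10 "-1"]] by simp

lift_definition scaleR_l2_10 :: "real \<Rightarrow> l2_10 \<Rightarrow> l2_10" is "\<lambda>r u x. r *\<^sub>R u x"
  by (simp add: scaleR_conv_of_real weighted_l2_mult)

definition dist_l2_10 :: "l2_10 \<Rightarrow> l2_10 \<Rightarrow> real"
  where "dist_l2_10 u v = norm (u - v)"

definition sgn_l2_10 :: "l2_10 \<Rightarrow> l2_10"
  where "sgn_l2_10 u = inverse (norm u) *\<^sub>R u"

definition uniformity_l2_10 :: "(l2_10 \<times> l2_10) filter"
  where "uniformity_l2_10 = (INF e\<in>{0 <..}. principal {(u, v). dist u v < e})"

definition open_l2_10 :: "l2_10 set \<Rightarrow> bool"
  where "open_l2_10 S = (\<forall>u\<in>S. \<forall>\<^sub>F (u', v) in uniformity. u' = u \<longrightarrow> v \<in> S)"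

instance
proof
  fix u v :: l2_10 and r :: real
  show "norm (r *\<^sub>R u) = \<bar>r\<bar> * norm u"
    by transfer (simp add: scaleR_conv_of_real weighted_l2_norm_mult)
qed (unfold dist_l2_10_def sgn_l2_10_def uniformity_l2_10_def open_l2_10_def,
    (rule refl | (transfer, force simp: algebra_simps weighted_l2_norm_triangle
      weighted_l2_norm_eq_0))+)

end

lift_definition delta0_l2 :: l2_10 is "\<lambda>x. complex_of_real (delta0 x)"
  by (rule weighted_l2_finite_support, rule finite_subset[of _ "{0}"]) (auto simp: delta0_def)

lift_definition P0_perp_l2 :: "l2_10 \<Rightarrow> l2_10" is P0_perp
  by (rule P0_perp_weighted_l2)


definition real_analytic_on :: "(real \<Rightarrow> 'a::real_normed_vector) \<Rightarrow> real set \<Rightarrow> bool"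
  where "real_analytic_on f S \<longleftrightarrow>
    (\<forall>t\<in>S. \<exists>r>0. \<exists>c :: nat \<Rightarrow> 'a. \<forall>s. \<bar>s - t\<bar> < r \<longrightarrow> (\<lambda>n. (s - t) ^ n *\<^sub>R c n) sums f s)"

text \<open>An arbitrary value where the derivatives do not exist; a map that is real analytic on
  an open set has all of them there, and so does \<open>t powr (1/6)\<close> for \<open>t > 0\<close>.\<close>

definition higher_vector_derivative ::
    "nat \<Rightarrow> (real \<Rightarrow> 'a::real_normed_vector) \<Rightarrow> real \<Rightarrow> 'a"
  where "higher_vector_derivative j f = ((\<lambda>g t. vector_derivative g (at t)) ^^ j) f"

end

theory Submission
  imports Defs
begin

text \<open>Writing \<open>\<phi> \<omega> = \<omega> powr (1/6) * \<psi>\<close> and \<open>e = 1 / \<omega>\<close> turns the equation into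
  \<open>\<psi> - \<psi>^7 = e * discrete_laplacian \<psi>\<close>, a regular perturbation of the solution \<open>delta0\<close> at
  \<open>e = 0\<close>. Solving formally in powers of \<open>e\<close> is a fixed point problem that converges in the
  adic sense: at \<open>x = 0\<close> the linearisation of \<open>\<psi> - \<psi>^7\<close> at \<open>1\<close> is multiplication by \<open>-6\<close>, at
  the other sites it is the identity. The fixed point map preserves a small ball of sequences of
  power series for the norms \<open>f \<mapsto> (\<Sum>n\<le>N. \<bar>f n\<bar> * r ^ n)\<close>, weighted by \<open>exp (20 * \<bar>x\<bar>)\<close>, for every \<open>N\<close>;
  as these norms are submultiplicative, the coefficients grow at most geometrically, with values in
  the weighted space. Hence \<open>\<phi>\<close> is a convergent series in the powers \<open>\<omega> powr (1/6 - n)\<close>, whose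
  leading term is \<open>\<omega> powr (1/6) * delta0\<close> and which can be differentiated termwise.\<close>

unbundle no vec_syntax
unbundle fps_syntax

section \<open>Series in descending powers\<close>

text \<open>For \<open>s > 0\<close> this is \<open>s powr p\<close> times a power series in
  \<open>1 / s\<close>. Keeping the exponent \<open>p - n\<close> inside each term makes
  differentiation a shift of \<open>p\<close> together with a scaling of the coefficients.\<close>

definition desc_series :: "real \<Rightarrow> (nat \<Rightarrow> 'a::banach) \<Rightarrow> real \<Rightarrow> 'a"
  where "desc_series p d s = (\<Sum>n. s powr (p - real n) *\<^sub>R d n)"

lemma powr_diff_nat: "0 < s \<Longrightarrow> s powr (p - real n) = s powr p * (1 / s) ^ n"
  by (simp add: powr_diff powr_realpow power_divide)

lemma norm_desc_series_term:
  fixes y :: "'a::real_normed_vector"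
  assumes "0 < s" "norm (y) \<le> K * D ^ n"
  shows "norm (s powr (p - real n) *\<^sub>R y) \<le> s powr p * K * (D / s) ^ n"
proof -
  have "norm (s powr (p - real n) *\<^sub>R y) \<le> s powr p * (1 / s) ^ n * (K * D ^ n)"
    using assms by (simp add: powr_diff_nat mult_left_mono)
  then show ?thesis by (simp add: power_divide mult.commute mult.left_commute)
qed

section \<open>Convergence and termwise differentiation under geometric coefficient bounds\<close>

context
  fixes d :: "nat \<Rightarrow> 'a::banach" and K D :: real
  assumes d: "\<And>n. norm (d n) \<le> K * D ^ n" and D: "0 < D"
begin

lemma summable_norm_desc_series:
  assumes "D < s"
  shows "summable (\<lambda>n. norm (s powr (p - real n) *\<^sub>R d n))"
proof (rule summable_comparison_test'[where N = 0])
  show "summable (\<lambda>n. s powr p * K * (D / s) ^ n)"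
    using assms D by (intro summable_mult summable_geometric) auto
  show "norm (norm (s powr (p - real n) *\<^sub>R d n)) \<le> s powr p * K * (D / s) ^ n" for n
    using norm_desc_series_term[OF _ d] assms D by simp
qed

lemma desc_series_sums:
  assumes "D < s"
  shows "(\<lambda>n. s powr (p - real n) *\<^sub>R d n) sums desc_series p d s"
  unfolding desc_series_def
  by (rule summable_sums[OF summable_norm_cancel[OF summable_norm_desc_series[OF assms]]])

text \<open>Without the leading term a factor \<open>D / s\<close> comes out of the series; the
  remaining geometric series has ratio at most \<open>1 / 2\<close>, hence sum at most
  \<open>2\<close>.\<close>

lemma norm_desc_series_le:
  assumes "d 0 = 0" "2 * D \<le> s"
  shows "norm (desc_series p d s) \<le> 2 * K * D * s powr (p - 1)"
proof -
  have s: "0 < s" "D < s" using assms D by auto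
  have K: "0 \<le> K" using order_trans[OF norm_ge_zero d[of 0]] by simp
  have geo: "(\<lambda>n. s powr p * K * (D / s) ^ n * (D / s)) sums (s powr p * K * (1 / (1 - D / s)) * (D / s))"
    using s D by (intro sums_mult2 sums_mult geometric_sums) auto
  have "norm (desc_series p d s) = norm (\<Sum>n. s powr (p - real (Suc n)) *\<^sub>R d (Suc n))"
    using suminf_split_head[OF sums_summable[OF desc_series_sums[OF s(2), of p]]] assms(1)
    by (simp add: desc_series_def)
  also have "\<dots> \<le> (\<Sum>n. s powr p * K * (D / s) ^ n * (D / s))"
  proof (rule norm_suminf_le)
    show "norm (s powr (p - real (Suc n)) *\<^sub>R d (Suc n)) \<le> s powr p * K * (D / s) ^ n * (D / s)" for n
      using norm_desc_series_term[OF s(1) d[of "Suc n"], of p] by (simp add: mult_ac)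
  qed (use geo in \<open>rule sums_summable\<close>)
  also have "\<dots> = s powr p * K * (D / s) * (1 / (1 - D / s))"
    using sums_unique[OF geo] by (simp add: mult_ac)
  also have "\<dots> \<le> s powr p * K * (D / s) * 2"
    using s D K assms(2) by (intro mult_left_mono) (auto simp: field_simps)
  also have "\<dots> = 2 * K * D * s powr (p - 1)"
    using s by (simp add: powr_diff)
  finally show ?thesis .
qed

lemma norm_desc_series_deriv_coeff:
  "norm ((p - real n) *\<^sub>R d n) \<le> ((\<bar>p\<bar> + 1) * K) * (2 * D) ^ n"
proof -
  have "\<bar>p - real n\<bar> \<le> \<bar>p\<bar> + real n" by simp
  also have "\<dots> \<le> \<bar>p\<bar> * 2 ^ n + 2 ^ n"
  proof (rule add_mono)
    show "\<bar>p\<bar> \<le> \<bar>p\<bar> * 2 ^ n"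
      using mult_left_mono[of 1 "2 ^ n" "\<bar>p\<bar>"] by simp
    show "real n \<le> 2 ^ n"
      using of_nat_less_two_power[of n, where 'a = real] by simp
  qed
  finally have "\<bar>p - real n\<bar> * norm (d n) \<le> ((\<bar>p\<bar> + 1) * 2 ^ n) * (K * D ^ n)"
    by (intro mult_mono d) (auto simp: algebra_simps)
  then show ?thesis by (simp add: power_mult_distrib mult_ac)
qed

text \<open>The differentiated series converges uniformly near \<open>t\<close> by the Weierstrass
  test. The new factors \<open>p - n\<close> are absorbed by doubling the rate, whence the threshold
  \<open>2 * D\<close>.\<close>

lemma has_vector_derivative_desc_series:
  assumes t: "2 * D < t"
  shows "(desc_series p d has_vector_derivative
    desc_series (p - 1) (\<lambda>n. (p - real n) *\<^sub>R d n) t) (at t)"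
proof -
  \<comment> \<open>A left endpoint strictly between \<open>2 * D\<close> and \<open>t\<close> gives
    the ratio \<open>2 * D / a < 1\<close> uniformly on \<open>S\<close>.\<close>
  obtain a where a: "2 * D < a" "a < t" using dense[OF t] by blast
  define S where "S = {a<..<t + 1}"
  have S: "convex S" "open S" "t \<in> S"
    using a by (auto simp: S_def)
  have pos: "0 < s" "a < s" if "s \<in> S" for s
    using that a D by (auto simp: S_def)
  \<comment> \<open>The power is monotone with a direction depending on the sign of
    \<open>p - 1\<close>; the sum of the two endpoint values covers both cases.\<close>
  define M where "M = a powr (p - 1) + (t + 1) powr (p - 1)"
  have M0: "0 \<le> M" by (simp add: M_def)
  have M: "s powr (p - 1) \<le> M" if "s \<in> S" for s
  proof (cases "0 \<le> p - 1")
    case True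
    then have "s powr (p - 1) \<le> (t + 1) powr (p - 1)"
      using that a D by (intro powr_mono2) (auto simp: S_def)
    then show ?thesis by (simp add: M_def add_increasing)
  next
    case False
    then have "s powr (p - 1) \<le> a powr (p - 1)"
      using that a D by (intro powr_mono2') (auto simp: S_def)
    then show ?thesis by (simp add: M_def add_increasing2)
  qed
  let ?f' = "\<lambda>n s. s powr (p - 1 - real n) *\<^sub>R (p - real n) *\<^sub>R d n"
  have K: "0 \<le> K" using order_trans[OF norm_ge_zero d[of 0]] by simp
  have "uniform_limit S (\<lambda>N s. \<Sum>n<N. ?f' n s) (\<lambda>s. \<Sum>n. ?f' n s) sequentially"
  proof (rule Weierstrass_m_test)
    fix n s assume s: "s \<in> S"
    have "norm (?f' n s) \<le> s powr (p - 1) * ((\<bar>p\<bar> + 1) * K) * (2 * D / s) ^ n"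
      by (rule norm_desc_series_term[OF pos(1)[OF s] norm_desc_series_deriv_coeff])
    also have "\<dots> \<le> M * ((\<bar>p\<bar> + 1) * K) * (2 * D / a) ^ n"
      using M[OF s] M0 pos[OF s] K D a
      by (intro mult_mono power_mono divide_left_mono) auto
    finally show "norm (?f' n s) \<le> M * ((\<bar>p\<bar> + 1) * K) * (2 * D / a) ^ n" .
  next
    show "summable (\<lambda>n. M * ((\<bar>p\<bar> + 1) * K) * (2 * D / a) ^ n)"
      using a D by (intro summable_mult summable_geometric) auto
  qed
  then have lim: "uniform_limit S (\<lambda>N s. \<Sum>n<N. ?f' n s)
      (desc_series (p - 1) (\<lambda>n. (p - real n) *\<^sub>R d n)) sequentially"
    by (simp add: desc_series_def[abs_def])
  have "\<exists>g. \<forall>s\<in>S. (\<lambda>n. s powr (p - real n) *\<^sub>R d n) sums g s \<and>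
      (g has_derivative (\<lambda>h. h *\<^sub>R desc_series (p - 1) (\<lambda>n. (p - real n) *\<^sub>R d n) s)) (at s within S)"
  proof (rule has_derivative_series[OF S(1) _ _ S(3)])
    show "((\<lambda>s. s powr (p - real n) *\<^sub>R d n) has_derivative (\<lambda>h. h *\<^sub>R ?f' n s)) (at s within S)"
      if "s \<in> S" for n s
    proof -
      have "((\<lambda>s. s powr (p - real n)) has_real_derivative (p - real n) * s powr (p - real n - 1)) (at s within S)"
        using has_real_derivative_powr[OF pos(1)[OF that], of "p - real n"]
        by (rule has_field_derivative_at_within)
      then have "((\<lambda>s. s powr (p - real n) *\<^sub>R d n) has_derivative
          (\<lambda>h. ((p - real n) * s powr (p - real n - 1) * h) *\<^sub>R d n)) (at s within S)"
        unfolding has_field_derivative_def by (rule has_derivative_scaleR_left)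
      moreover have "p - real n - 1 = p - 1 - real n" by simp
      ultimately show ?thesis
        by (simp only: scaleR_scaleR mult_ac)
    qed
    show "\<forall>\<^sub>F N in sequentially. \<forall>s\<in>S. \<forall>h. norm ((\<Sum>n<N. h *\<^sub>R ?f' n s)
        - h *\<^sub>R desc_series (p - 1) (\<lambda>n. (p - real n) *\<^sub>R d n) s) \<le> e * norm h" if "0 < e" for e
      using uniform_limitD[OF lim that]
    proof eventually_elim
      case (elim N)
      show ?case
      proof (intro ballI allI)
        fix s h assume "s \<in> S"
        then have "norm ((\<Sum>n<N. ?f' n s) - desc_series (p - 1) (\<lambda>n. (p - real n) *\<^sub>R d n) s) \<le> e"
          using elim by (auto simp: dist_norm less_imp_le)
        then show "norm ((\<Sum>n<N. h *\<^sub>R ?f' n s)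
            - h *\<^sub>R desc_series (p - 1) (\<lambda>n. (p - real n) *\<^sub>R d n) s) \<le> e * norm h"
          unfolding scaleR_sum_right[symmetric] scaleR_diff_right[symmetric]
            norm_scaleR real_norm_def mult.commute[of e]
          by (rule mult_left_mono) simp
      qed
    qed
    show "(\<lambda>n. t powr (p - real n) *\<^sub>R d n) sums desc_series p d t"
      using t D by (intro desc_series_sums) simp
  qed
  then obtain g where g: "\<And>s. s \<in> S \<Longrightarrow> (\<lambda>n. s powr (p - real n) *\<^sub>R d n) sums g s"
    "(g has_vector_derivative desc_series (p - 1) (\<lambda>n. (p - real n) *\<^sub>R d n) t) (at t within S)"
    using S(3) unfolding has_vector_derivative_def by blast
  have eq: "g s = desc_series p d s" if "s \<in> S" for s
    using sums_unique[OF g(1)[OF that]] by (simp add: desc_series_def)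
  have "(g has_vector_derivative desc_series (p - 1) (\<lambda>n. (p - real n) *\<^sub>R d n) t) (at t)"
    using g(2) at_within_open[OF S(3,2)] by simp
  then show ?thesis
    by (rule has_vector_derivative_transform_within_open[OF _ S(2,3) eq])
qed

end

text \<open>Differentiating termwise at most doubles the geometric rate of the coefficients, since
  \<open>n \<le> 2 ^ n\<close>.\<close>

definition deriv_coeff :: "real \<Rightarrow> nat \<Rightarrow> (nat \<Rightarrow> 'a::real_vector) \<Rightarrow> nat \<Rightarrow> 'a"
  where "deriv_coeff p j d n = (\<Prod>i<j. p - real i - real n) *\<^sub>R d n"

lemma deriv_coeff_Suc: "deriv_coeff p (Suc j) d n = (p - real j - real n) *\<^sub>R deriv_coeff p j d n"
  by (simp add: deriv_coeff_def mult.commute)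

lemma norm_deriv_coeff:
  fixes d :: "nat \<Rightarrow> 'a::banach"
  assumes "\<And>n. norm (d n) \<le> K * D ^ n" "0 < D"
  shows "norm (deriv_coeff p j d n) \<le> K * (\<Prod>i<j. \<bar>p - real i\<bar> + 1) * (2 ^ j * D) ^ n"
proof (induction j arbitrary: n)
  case 0
  then show ?case using assms by (simp add: deriv_coeff_def)
next
  case (Suc j)
  have "0 < 2 ^ j * D" using assms(2) by simp
  from norm_desc_series_deriv_coeff[OF Suc this, of "p - real j" n]
  show ?case by (simp add: deriv_coeff_Suc mult_ac)
qed

lemma higher_vector_derivative_desc_series:
  fixes d :: "nat \<Rightarrow> 'a::banach"
  assumes d: "\<And>n. norm (d n) \<le> K * D ^ n" and D: "0 < D"
    and "2 ^ j * D < s"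
  shows "higher_vector_derivative j (desc_series p d) s = desc_series (p - real j) (deriv_coeff p j d) s"
  using assms(3)
proof (induction j arbitrary: s)
  case 0
  then show ?case by (simp add: higher_vector_derivative_def deriv_coeff_def)
next
  case (Suc j)
  have D': "0 < 2 ^ j * D" using D by simp
  let ?S = "{2 ^ j * D<..}"
  have "(desc_series (p - real j) (deriv_coeff p j d) has_vector_derivative
      desc_series (p - real (Suc j)) (deriv_coeff p (Suc j) d) s) (at s)"
    using has_vector_derivative_desc_series[OF norm_deriv_coeff[OF d D, of p j] D', of s "p - real j"] Suc.prems
    by (simp add: deriv_coeff_Suc[abs_def] diff_diff_eq add.commute)
  then have "(higher_vector_derivative j (desc_series p d) has_vector_derivative
      desc_series (p - real (Suc j)) (deriv_coeff p (Suc j) d) s) (at s)"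
  \<comment> \<open>The induction hypothesis identifies the two functions only on an open half-line;
    as a neighbourhood of \<open>s\<close> this determines the derivative.\<close>
  proof (rule has_vector_derivative_transform_within_open[where S = ?S])
    show "s \<in> ?S" using Suc.prems D' by simp
    show "desc_series (p - real j) (deriv_coeff p j d) y = higher_vector_derivative j (desc_series p d) y"
      if "y \<in> ?S" for y
      using Suc.IH[of y] that by simp
  qed simp
  then show ?case
    by (simp add: higher_vector_derivative_def vector_derivative_at)
qed

text \<open>The recursion in \<open>k\<close> for \<open>a gchoose k\<close> has the factor
  \<open>a - k\<close>, of modulus at most \<open>m + k + 1\<close>, so it is dominated by the
  recursion for \<open>m + k choose k\<close>. It is used with \<open>a = p - n\<close> and
  \<open>m = n\<close>.\<close>

lemma abs_gbinomial_le:
  assumes "\<bar>a\<bar> \<le> real m + 1"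
  shows "\<bar>a gchoose k\<bar> \<le> 2 ^ (m + k)"
proof -
  have "\<bar>a gchoose k\<bar> \<le> real (m + k choose k)"
  proof (induction k)
    case (Suc k)
    have "real (Suc k) * (a gchoose Suc k) = (a - real k) * (a gchoose k)"
      using gbinomial_mult_1[of a k] by (simp add: algebra_simps)
    then have "real (Suc k) * \<bar>a gchoose Suc k\<bar> = \<bar>a - real k\<bar> * \<bar>a gchoose k\<bar>"
      by (metis abs_mult abs_of_nat)
    also have "\<dots> \<le> real (Suc (m + k)) * real (m + k choose k)"
      using assms Suc by (intro mult_mono) auto
    also have "\<dots> = real (Suc k) * real (m + Suc k choose Suc k)"
      using Suc_times_binomial_eq[of "m + k" k] by (metis add_Suc_right mult.commute of_nat_mult)
    finally show ?case by simp
  qed simp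
  also have "\<dots> \<le> 2 ^ (m + k)"
    using binomial_le_pow2[of "m + k" k] by (metis of_nat_le_iff of_nat_numeral of_nat_power)
  finally show ?thesis .
qed

text \<open>Each power of \<open>s\<close> is expanded at \<open>t\<close> by the binomial series,
  and the resulting double series is summed in the other order. The binomial bound costs
  \<open>2 ^ (n + k)\<close>, so absolute convergence needs \<open>2 * D < t\<close> for
  \<open>n\<close> and \<open>2 * \<bar>s - t\<bar> < t\<close> for \<open>k\<close>.\<close>

lemma real_analytic_on_desc_series:
  fixes d :: "nat \<Rightarrow> 'a::banach"
  assumes d: "\<And>n. norm (d n) \<le> K * D ^ n" and D: "0 < D" and p: "\<bar>p\<bar> \<le> 1"
  shows "real_analytic_on (desc_series p d) {2 * D<..}"
  unfolding real_analytic_on_def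
proof
  fix t assume "t \<in> {2 * D<..}"
  then have t: "2 * D < t" "0 < t" using D by auto
  have K: "0 \<le> K" using order_trans[OF norm_ge_zero d[of 0]] by simp
  \<comment> \<open>\<open>a n k\<close> is the coefficient of \<open>(s - t) ^ k\<close> in the
    expansion of \<open>s powr (p - real n)\<close>; \<open>c k\<close> collects the contributions
    of all \<open>n\<close> to that power.\<close>
  define a where "a n k = ((p - real n) gchoose k) * t powr (p - real n - real k)" for n k
  define c where "c k = (\<Sum>\<^sub>\<infinity>n. a n k *\<^sub>R d n)" for k
  have coeff_bound: "norm (a n k *\<^sub>R d n) \<le> t powr p * K * (2 / t) ^ k * (2 * D / t) ^ n" for n k
  proof -
    have "\<bar>a n k\<bar> \<le> 2 ^ (n + k) * (t powr p * (1 / t) ^ (n + k))"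
      unfolding a_def abs_mult
      using t abs_gbinomial_le[of "p - real n" n k] p powr_diff_nat[of t p "n + k"]
      by (intro mult_mono) (auto simp: diff_diff_eq)
    then have "\<bar>a n k\<bar> * norm (d n) \<le> (2 ^ (n + k) * (t powr p * (1 / t) ^ (n + k))) * (K * D ^ n)"
      using d[of n] t by (intro mult_mono) auto
    also have "\<dots> = t powr p * K * (2 / t) ^ k * (2 * D / t) ^ n"
      by (simp add: power_add power_mult_distrib power_divide mult_ac)
    finally show ?thesis by simp
  qed
  have c: "((\<lambda>n. a n k *\<^sub>R d n) has_sum c k) UNIV" for k
  proof -
    have "summable (\<lambda>n. t powr p * K * (2 / t) ^ k * (2 * D / t) ^ n)"
      using t D by (intro summable_mult summable_geometric) auto
    then have "summable (\<lambda>n. norm (a n k *\<^sub>R d n))"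
      by (rule summable_comparison_test'[where N = 0]) (use coeff_bound in simp)
    then show ?thesis
      unfolding c_def by (intro has_sum_infsum norm_summable_imp_summable_on)
  qed
  show "\<exists>r>0. \<exists>c. \<forall>s. \<bar>s - t\<bar> < r \<longrightarrow> (\<lambda>k. (s - t) ^ k *\<^sub>R c k) sums desc_series p d s"
  proof (intro exI conjI allI impI)
    show "0 < t / 2" using t by simp
    fix s assume s: "\<bar>s - t\<bar> < t / 2"
    define q where "q = 2 * \<bar>s - t\<bar> / t"
    have q: "0 \<le> q" "q < 1" using s t by (auto simp: q_def)
    let ?h = "\<lambda>(n, k). (s - t) ^ k *\<^sub>R a n k *\<^sub>R d n"
    have bound: "norm (?h (n, k)) \<le> t powr p * K * (2 * D / t) ^ n * q ^ k" for n k
    proof -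
      have "\<bar>s - t\<bar> ^ k * norm (a n k *\<^sub>R d n) \<le>
          \<bar>s - t\<bar> ^ k * (t powr p * K * (2 / t) ^ k * (2 * D / t) ^ n)"
        by (rule mult_left_mono[OF coeff_bound]) simp
      also have "\<dots> = t powr p * K * (2 * D / t) ^ n * q ^ k"
        by (simp add: q_def power_mult_distrib power_divide mult_ac)
      finally show ?thesis by (simp add: abs_mult power_abs mult.assoc)
    qed
    have "((\<lambda>k. q ^ k) has_sum 1 / (1 - q)) UNIV"
      by (intro norm_summable_imp_has_sum geometric_sums)
        (use q in \<open>auto simp: power_abs intro: summable_geometric\<close>)
    then have geo: "((\<lambda>k. t powr p * K * (2 * D / t) ^ n * q ^ k) has_sum
        t powr p * K * (2 * D / t) ^ n * (1 / (1 - q))) UNIV" for n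
      by (rule has_sum_cmult_right)
    have abs: "(\<lambda>x. norm (?h x)) summable_on UNIV \<times> UNIV"
    proof (rule summable_on_comparison_test)
      show "(\<lambda>(n, k). t powr p * K * (2 * D / t) ^ n * q ^ k) summable_on UNIV \<times> UNIV"
      proof (rule summable_on_SigmaI)
        show "((\<lambda>k. case (n, k) of (n, k) \<Rightarrow> t powr p * K * (2 * D / t) ^ n * q ^ k) has_sum
            t powr p * K * (2 * D / t) ^ n * (1 / (1 - q))) UNIV" for n
          using geo by simp
        show "(\<lambda>n. t powr p * K * (2 * D / t) ^ n * (1 / (1 - q))) summable_on UNIV"
          using t D K q by (subst summable_on_UNIV_nonneg_real_iff)
            (auto intro!: summable_mult summable_mult2 summable_geometric)
      qed (use t D K q in auto)
    qed (use bound in auto)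
    then have summ: "?h summable_on UNIV \<times> UNIV" by (rule abs_summable_summable)
    have row: "((\<lambda>k. ?h (n, k)) has_sum s powr (p - real n) *\<^sub>R d n) UNIV" for n
    proof -
      have "(\<lambda>k. ((p - real n) gchoose k) * (s - t) ^ k * t powr (p - real n - real k))
          sums ((s - t) + t) powr (p - real n)"
        by (rule gen_binomial_real') (use s t in auto)
      then have "(\<lambda>k. (((p - real n) gchoose k) * (s - t) ^ k * t powr (p - real n - real k)) *\<^sub>R d n)
          sums (s powr (p - real n) *\<^sub>R d n)"
        using bounded_linear.sums[OF bounded_linear_scaleR_left] by fastforce
      then have "(\<lambda>k. ?h (n, k)) sums (s powr (p - real n) *\<^sub>R d n)"
        by (simp add: a_def mult_ac)
      moreover have "summable (\<lambda>k. norm (?h (n, k)))"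
        using bound[of n] has_sum_imp_sums[OF geo[of n]]
        by (intro summable_comparison_test'[OF sums_summable]) auto
      ultimately show ?thesis by (intro norm_summable_imp_has_sum)
    qed
    have "D < s" using s t by linarith
    then have "((\<lambda>n. s powr (p - real n) *\<^sub>R d n) has_sum desc_series p d s) UNIV"
      using summable_norm_desc_series[of d K D s p] desc_series_sums[of d K D s p] d D
      by (intro norm_summable_imp_has_sum) auto
    then have tot: "(?h has_sum desc_series p d s) (UNIV \<times> UNIV)"
      using has_sum_SigmaI[OF row _ summ] by simp
    \<comment> \<open>Row sums gave the value of the series; the column sums of the same family are
      the terms of the power series at \<open>t\<close>.\<close>
    have swap: "((\<lambda>(k, n). ?h (n, k)) has_sum desc_series p d s) (UNIV \<times> UNIV)"
      using tot has_sum_swap by blast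
    have col: "((\<lambda>n. ?h (n, k)) has_sum (s - t) ^ k *\<^sub>R c k) UNIV" for k
      using has_sum_scaleR[OF c, of "(s - t) ^ k" k] by simp
    show "(\<lambda>k. (s - t) ^ k *\<^sub>R c k) sums desc_series p d s"
      by (rule has_sum_imp_sums, rule has_sum_SigmaD[OF swap]) (use col in auto)
  qed
qed

section \<open>Comparison with the leading power\<close>

lemma desc_series_single: "desc_series p (\<lambda>n. if n = 0 then y else 0) s = s powr p *\<^sub>R y"
  unfolding desc_series_def by (subst suminf_finite[of "{0}"]) auto

text \<open>A pure power is a series whose coefficients decay at any geometric rate.\<close>

lemma higher_vector_derivative_powr:
  fixes y :: "'a::banach"
  assumes s: "0 < s"
  shows "higher_vector_derivative j (\<lambda>t. t powr p *\<^sub>R y) s =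
    (s powr (p - real j) * (\<Prod>i<j. p - real i)) *\<^sub>R y"
proof -
  let ?d = "\<lambda>n::nat. if n = 0 then y else 0"
  \<comment> \<open>The rate \<open>s / 2 ^ Suc j\<close> makes the threshold
    \<open>2 ^ j * D\<close> equal to \<open>s / 2\<close>, below \<open>s\<close>.\<close>
  have "higher_vector_derivative j (desc_series p ?d) s =
      desc_series (p - real j) (deriv_coeff p j ?d) s"
    using s by (intro higher_vector_derivative_desc_series[where K = "norm y" and D = "s / 2 ^ Suc j"]) auto
  moreover have "deriv_coeff p j ?d = (\<lambda>n. if n = 0 then (\<Prod>i<j. p - real i) *\<^sub>R y else 0)"
    by (auto simp: deriv_coeff_def)
  ultimately show ?thesis
    by (simp add: desc_series_single[abs_def])
qed

text \<open>The derivative of the leading power is the leading term of the differentiated series.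
  The difference is therefore a series with vanishing coefficient at \<open>0\<close>, which gains
  one power of \<open>1 / s\<close>.\<close>

lemma norm_higher_vector_derivative_diff:
  fixes d :: "nat \<Rightarrow> 'a::banach"
  assumes d: "\<And>n. norm (d n) \<le> K * D ^ n" and D: "0 < D" and s: "2 ^ Suc j * D \<le> s"
  shows "norm (higher_vector_derivative j (desc_series p d) s
      - higher_vector_derivative j (\<lambda>t. t powr p *\<^sub>R d 0) s)
    \<le> 2 * (K * (\<Prod>i<j. \<bar>p - real i\<bar> + 1)) * (2 ^ j * D) * s powr (p - real j - 1)"
proof -
  let ?b = "deriv_coeff p j d"
  let ?e = "\<lambda>n. if n = 0 then 0 else ?b n"
  let ?B = "K * (\<Prod>i<j. \<bar>p - real i\<bar> + 1)"
  have D': "0 < 2 ^ j * D" using D by simp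
  have s': "2 ^ j * D < s" "2 * (2 ^ j * D) \<le> s" "0 < s" using s D' by auto
  have b: "norm (?b n) \<le> ?B * (2 ^ j * D) ^ n" for n
    by (rule norm_deriv_coeff[OF d D])
  have e: "norm (?e n) \<le> ?B * (2 ^ j * D) ^ n" for n
    using order_trans[OF norm_ge_zero b[of n]] b[of n] by (cases "n = 0") simp_all
  have "(\<lambda>n. s powr (p - real j - real n) *\<^sub>R (if n = 0 then ?b 0 else 0)) sums
      (s powr (p - real j) *\<^sub>R ?b 0)"
    using sums_single[of 0 "\<lambda>n. s powr (p - real j - real n) *\<^sub>R ?b 0"]
    by (simp add: if_distrib cong: if_cong)
  from sums_diff[OF desc_series_sums[OF b D' s'(1), of "p - real j"] this]
  have "(\<lambda>n. s powr (p - real j - real n) *\<^sub>R ?e n) sums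
      (desc_series (p - real j) ?b s - s powr (p - real j) *\<^sub>R ?b 0)"
    by (rule sums_cong[THEN iffD1, rotated]) auto
  then have "desc_series (p - real j) ?e s = desc_series (p - real j) ?b s - s powr (p - real j) *\<^sub>R ?b 0"
    unfolding desc_series_def[of _ ?e] by (rule sums_unique[symmetric])
  also have "\<dots> = higher_vector_derivative j (desc_series p d) s
      - higher_vector_derivative j (\<lambda>t. t powr p *\<^sub>R d 0) s"
    using higher_vector_derivative_desc_series[OF d D s'(1), of p]
      higher_vector_derivative_powr[OF s'(3), of j p "d 0"] by (simp add: deriv_coeff_def)
  finally show ?thesis
    using norm_desc_series_le[OF e D' _ s'(2), of "p - real j"] by simp
qed

section \<open>The weighted sequence space\<close>

text \<open>The rate is twice the exponent \<open>10\<close> of the weight, so that the squared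
  weighted values of \<open>decay\<close> are \<open>decay\<close> itself, which is
  summable.\<close>

definition decay :: "int \<Rightarrow> real"
  where "decay x = exp (- 20 * real_of_int \<bar>x\<bar>)"

text \<open>The terms are nonnegative, so bounds on finite sets of sites give membership and norm at
  once; later estimates need only finite sums.\<close>

lemma weighted_l2_norm_leI:
  assumes "0 \<le> M"
    and "\<And>F. finite F \<Longrightarrow> L2_set (\<lambda>x. cmod (complex_of_real (exp (a * real_of_int \<bar>x\<bar>)) * u x)) F \<le> M"
  shows "u \<in> weighted_l2 a" "weighted_l2_norm a u \<le> M"
proof -
  let ?g = "\<lambda>x. (cmod (complex_of_real (exp (a * real_of_int \<bar>x\<bar>)) * u x))\<^sup>2"
  have le: "sum ?g F \<le> M\<^sup>2" if "finite F" for F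
    using assms(2)[OF that] unfolding L2_set_def by (rule sqrt_le_D)
  have sum: "?g summable_on UNIV"
    by (rule nonneg_bdd_above_summable_on, simp, rule bdd_aboveI2[where M = "M\<^sup>2"])
      (use le in blast)
  then show "u \<in> weighted_l2 a"
    by (simp add: weighted_l2_def)
  have "infsum ?g UNIV \<le> M\<^sup>2"
    by (rule infsum_le_finite_sums[OF sum]) (use le in auto)
  then show "weighted_l2_norm a u \<le> M"
    unfolding weighted_l2_norm_def using \<open>0 \<le> M\<close> by (rule real_le_lsqrt[rotated])
qed

lemma cmod_le_weighted_l2_norm:
  assumes "u \<in> weighted_l2 a" "0 \<le> a"
  shows "cmod (u x) \<le> weighted_l2_norm a u"
proof -
  have "cmod (u x) \<le> exp (a * real_of_int \<bar>x\<bar>) * cmod (u x)"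
    using assms(2) by (simp add: mult_le_cancel_right1)
  also have "\<dots> \<le> weighted_l2_norm a u"
    using L2_set_le_weighted_l2_norm[OF assms(1), of "{x}"] by (simp add: L2_set_def norm_mult)
  finally show ?thesis .
qed

lemma cmod_l2_10_apply_le: "cmod (l2_10_apply u x) \<le> norm u"
  using cmod_le_weighted_l2_norm[OF l2_10_apply, of u x] by (simp add: norm_l2_10.rep_eq)

lemma bounded_linear_l2_10_apply: "bounded_linear (\<lambda>u. l2_10_apply u x)"
  by (rule bounded_linear_intro[where K = 1])
    (auto simp: plus_l2_10.rep_eq scaleR_l2_10.rep_eq cmod_l2_10_apply_le)

text \<open>Evaluation at a site is bounded, so a Cauchy sequence converges pointwise, and the
  Cauchy bound survives in the limit. Completeness is what gives the vector-valued series their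
  sums.\<close>

instance l2_10 :: banach
proof
  fix X :: "nat \<Rightarrow> l2_10"
  assume X: "Cauchy X"
  let ?w = "\<lambda>x. complex_of_real (exp (10 * real_of_int \<bar>x\<bar>))"
  have "\<exists>l. (\<lambda>n. l2_10_apply (X n) x) \<longlonglongrightarrow> l" for x
    using bounded_linear.Cauchy[OF bounded_linear_l2_10_apply X]
    by (simp add: Cauchy_convergent_iff convergent_def)
  then obtain v where v: "\<And>x. (\<lambda>n. l2_10_apply (X n) x) \<longlonglongrightarrow> v x"
    by metis
  have tail: "\<exists>N. \<forall>n\<ge>N. (\<lambda>x. l2_10_apply (X n) x - v x) \<in> weighted_l2 10 \<and>
      weighted_l2_norm 10 (\<lambda>x. l2_10_apply (X n) x - v x) \<le> e" if e: "0 < e" for e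
  proof -
    obtain N where N: "\<And>m n. N \<le> m \<Longrightarrow> N \<le> n \<Longrightarrow> norm (X n - X m) < e"
      using CauchyD[OF X e] by metis
    \<comment> \<open>Only \<open>m\<close> tends to infinity, over a finite set of sites; since
      \<open>N\<close> does not depend on \<open>F\<close>, the bound extends to all sites.\<close>
    have "L2_set (\<lambda>x. cmod (?w x * (l2_10_apply (X n) x - v x))) F \<le> e"
      if "N \<le> n" "finite F" for n F
    proof (rule tendsto_upperbound)
      show "(\<lambda>m. L2_set (\<lambda>x. cmod (?w x * (l2_10_apply (X n) x - l2_10_apply (X m) x))) F)
          \<longlonglongrightarrow> L2_set (\<lambda>x. cmod (?w x * (l2_10_apply (X n) x - v x))) F"
        unfolding L2_set_def by (intro tendsto_intros v)
      have "L2_set (\<lambda>x. cmod (?w x * (l2_10_apply (X n) x - l2_10_apply (X m) x))) F \<le> e"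
        if "N \<le> m" for m
        using L2_set_le_weighted_l2_norm[OF l2_10_apply[of "X n - X m"] \<open>finite F\<close>]
          N[OF that \<open>N \<le> n\<close>] by (simp add: minus_l2_10.rep_eq norm_l2_10.rep_eq)
      then show "\<forall>\<^sub>F m in sequentially.
          L2_set (\<lambda>x. cmod (?w x * (l2_10_apply (X n) x - l2_10_apply (X m) x))) F \<le> e"
        unfolding eventually_sequentially by blast
    qed simp
    then show ?thesis
      using weighted_l2_norm_leI[of e 10] \<open>0 < e\<close> by (meson less_imp_le)
  qed
  \<comment> \<open>The limit is \<open>X n\<close> minus the difference \<open>X n - v\<close>,
    both of which lie in the space.\<close>
  obtain n where "(\<lambda>x. l2_10_apply (X n) x - v x) \<in> weighted_l2 10"
    using tail[of 1] by auto
  from weighted_l2_add[OF l2_10_apply[of "X n"] weighted_l2_mult[OF this, of "-1"]]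
  have mem: "v \<in> weighted_l2 10" by simp
  have "X \<longlonglongrightarrow> Abs_l2_10 v"
    unfolding LIMSEQ_iff
  proof (intro allI impI)
    fix r :: real assume "0 < r"
    have "norm (X n - Abs_l2_10 v) = weighted_l2_norm 10 (\<lambda>x. l2_10_apply (X n) x - v x)" for n
      by (simp add: norm_l2_10.rep_eq minus_l2_10.rep_eq Abs_l2_10_inverse[OF mem])
    then show "\<exists>N. \<forall>n\<ge>N. norm (X n - Abs_l2_10 v) < r"
      using tail[of "r / 2"] \<open>0 < r\<close> by fastforce
  qed
  then show "convergent X" by (rule convergentI)
qed

section \<open>Decaying sequences and the projection off the origin\<close>

lemma summable_on_decay: "decay summable_on UNIV"
proof -
  have nat: "(\<lambda>n. decay (int n)) summable_on UNIV" "(\<lambda>n. decay (- int n)) summable_on UNIV"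
  proof -
    have "summable (\<lambda>n. exp (- 20 :: real) ^ n)"
      by (rule summable_geometric) simp
    moreover have "decay (int n) = exp (- 20) ^ n" "decay (- int n) = exp (- 20) ^ n" for n
      by (simp_all add: decay_def mult.commute flip: exp_of_nat_mult)
    ultimately show "(\<lambda>n. decay (int n)) summable_on UNIV" "(\<lambda>n. decay (- int n)) summable_on UNIV"
      by (simp_all add: summable_on_UNIV_nonneg_real_iff)
  qed
  have "decay summable_on (range int)" "decay summable_on (range (\<lambda>n. - int n))"
    using nat by (simp_all add: summable_on_reindex inj_on_def comp_def)
  then have "decay summable_on (range int \<union> range (\<lambda>n. - int n))"
    by (rule summable_on_union)
  moreover have "range int \<union> range (\<lambda>n. - int n) = UNIV"
    by (auto simp: image_iff intro: int_cases2)
  ultimately show ?thesis by simp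
qed

lemma weighted_l2_decay:
  assumes "0 \<le> M" and u: "\<And>x. cmod (u x) \<le> M * decay x"
  shows "u \<in> weighted_l2 10" "weighted_l2_norm 10 u \<le> M * sqrt (infsum decay UNIV)"
proof -
  have "L2_set (\<lambda>x. cmod (complex_of_real (exp (10 * real_of_int \<bar>x\<bar>)) * u x)) F
      \<le> M * sqrt (infsum decay UNIV)" if "finite F" for F
  proof -
    have "(cmod (complex_of_real (exp (10 * real_of_int \<bar>x\<bar>)) * u x))\<^sup>2 \<le> M\<^sup>2 * decay x" for x
    proof -
      have "exp (10 * real_of_int \<bar>x\<bar>) * cmod (u x) \<le> exp (10 * real_of_int \<bar>x\<bar>) * (M * decay x)"
        using u[of x] by (intro mult_left_mono) auto
      also have "\<dots> = M * exp (- 10 * real_of_int \<bar>x\<bar>)"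
        by (simp add: decay_def mult.left_commute mult_exp_exp)
      finally have "(exp (10 * real_of_int \<bar>x\<bar>) * cmod (u x))\<^sup>2 \<le> (M * exp (- 10 * real_of_int \<bar>x\<bar>))\<^sup>2"
        by (rule power_mono) simp
      also have "\<dots> = M\<^sup>2 * decay x"
        by (simp add: decay_def power_mult_distrib flip: exp_double)
      finally show ?thesis by (simp add: norm_mult)
    qed
    then have "(\<Sum>x\<in>F. (cmod (complex_of_real (exp (10 * real_of_int \<bar>x\<bar>)) * u x))\<^sup>2)
        \<le> (\<Sum>x\<in>F. M\<^sup>2 * decay x)"
      by (rule sum_mono)
    also have "\<dots> \<le> M\<^sup>2 * infsum decay UNIV"
      unfolding sum_distrib_left[symmetric]
      by (intro mult_left_mono finite_sum_le_infsum summable_on_decay that) (auto simp: decay_def)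
    finally show ?thesis
      using \<open>0 \<le> M\<close> unfolding L2_set_def
      by (metis real_sqrt_le_iff real_sqrt_mult real_sqrt_abs abs_of_nonneg)
  qed
  moreover have "0 \<le> M * sqrt (infsum decay UNIV)"
    using assms(1) by (simp add: infsum_nonneg decay_def)
  ultimately show "u \<in> weighted_l2 10" "weighted_l2_norm 10 u \<le> M * sqrt (infsum decay UNIV)"
    using weighted_l2_norm_leI[of _ 10 u] by blast+
qed

text \<open>The projection erases the value at one site, so no weighted term grows.\<close>

lemma bounded_linear_P0_perp_l2: "bounded_linear P0_perp_l2" (is ?lin)
  and norm_P0_perp_l2_le: "norm (P0_perp_l2 u) \<le> norm u"
proof -
  have le: "norm (P0_perp_l2 u) \<le> norm u" for u
  proof -
    have "weighted_l2_norm 10 (P0_perp (l2_10_apply u)) \<le> weighted_l2_norm 10 (l2_10_apply u)"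
    proof (rule weighted_l2_norm_leI(2)[OF weighted_l2_norm_nonneg])
      fix F :: "int set" assume "finite F"
      let ?w = "\<lambda>x. complex_of_real (exp (10 * real_of_int \<bar>x\<bar>))"
      have "L2_set (\<lambda>x. cmod (?w x * P0_perp (l2_10_apply u) x)) F
          \<le> L2_set (\<lambda>x. cmod (?w x * l2_10_apply u x)) F"
        by (rule L2_set_mono) (auto simp: P0_perp_def delta0_def)
      also have "\<dots> \<le> weighted_l2_norm 10 (l2_10_apply u)"
        using l2_10_apply \<open>finite F\<close> by (rule L2_set_le_weighted_l2_norm)
      finally show "L2_set (\<lambda>x. cmod (?w x * P0_perp (l2_10_apply u) x)) F
          \<le> weighted_l2_norm 10 (l2_10_apply u)" .
    qed
    then show ?thesis by (simp add: norm_l2_10.rep_eq P0_perp_l2.rep_eq)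
  qed
  then show "norm (P0_perp_l2 u) \<le> norm u" .
  show ?lin
  proof (rule bounded_linear_intro[where K = 1])
    show "P0_perp_l2 (u + v) = P0_perp_l2 u + P0_perp_l2 v" for u v
      by transfer (simp add: P0_perp_def algebra_simps fun_eq_iff)
    show "P0_perp_l2 (r *\<^sub>R u) = r *\<^sub>R P0_perp_l2 u" for r u
      by transfer (simp add: P0_perp_def algebra_simps fun_eq_iff scaleR_conv_of_real)
    show "norm (P0_perp_l2 u) \<le> norm u * 1" for u
      using le by simp
  qed
qed

lemma P0_perp_delta0: "P0_perp_l2 delta0_l2 = 0"
  by transfer (auto simp: P0_perp_def delta0_def)

section \<open>Formal solution in powers of the inverse frequency\<close>

text \<open>The cut at order \<open>N\<close> makes this finite for every formal series, so
  estimates are available before convergence is known. Bounds uniform in \<open>N\<close> later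
  become geometric coefficient bounds.\<close>

definition tnorm :: "real \<Rightarrow> nat \<Rightarrow> real fps \<Rightarrow> real"
  where "tnorm r N f = (\<Sum>n\<le>N. \<bar>f $ n\<bar> * r ^ n)"

lemma tnorm_nonneg: "0 \<le> r \<Longrightarrow> 0 \<le> tnorm r N f"
  by (simp add: tnorm_def sum_nonneg)

lemma tnorm_0 [simp]: "tnorm r N 0 = 0"
  by (simp add: tnorm_def)

lemma tnorm_add: "0 \<le> r \<Longrightarrow> tnorm r N (f + g) \<le> tnorm r N f + tnorm r N g"
  unfolding tnorm_def sum.distrib[symmetric] distrib_right[symmetric]
  by (intro sum_mono mult_right_mono) auto

lemma tnorm_const_mult: "tnorm r N (fps_const c * f) = \<bar>c\<bar> * tnorm r N f"
  by (simp add: tnorm_def abs_mult sum_distrib_left mult.assoc)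

lemma tnorm_const: "tnorm r N (fps_const c) = \<bar>c\<bar>"
proof -
  have "tnorm r N (fps_const c) = (\<Sum>n\<le>N. if n = 0 then \<bar>c\<bar> else 0)"
    unfolding tnorm_def by (intro sum.cong) auto
  then show ?thesis by simp
qed

lemma tnorm_numeral_mult: "tnorm r N (numeral k * f) = numeral k * tnorm r N f"
  using tnorm_const_mult[of r N "numeral k" f] by (simp add: numeral_fps_const)

text \<open>The Cauchy product truncated at \<open>N\<close> runs over the triangle
  \<open>i + j \<le> N\<close>, which lies inside the square of the product of the norms; all terms
  are nonnegative.\<close>

lemma tnorm_mult:
  assumes "0 \<le> r"
  shows "tnorm r N (f * g) \<le> tnorm r N f * tnorm r N g"
proof -
  let ?a = "\<lambda>i. \<bar>f $ i\<bar> * r ^ i" and ?b = "\<lambda>i. \<bar>g $ i\<bar> * r ^ i"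
  have "tnorm r N (f * g) \<le> (\<Sum>n\<le>N. \<Sum>i\<le>n. ?a i * ?b (n - i))"
    unfolding tnorm_def
  proof (rule sum_mono)
    fix n
    have "\<bar>(f * g) $ n\<bar> * r ^ n \<le> (\<Sum>i\<le>n. \<bar>f $ i * g $ (n - i)\<bar>) * r ^ n"
      using assms by (auto simp: fps_mult_nth atLeast0AtMost intro!: mult_right_mono sum_abs)
    also have "\<dots> = (\<Sum>i\<le>n. ?a i * ?b (n - i))"
      unfolding sum_distrib_right
    proof (rule sum.cong)
      fix i assume "i \<in> {..n}"
      then have "r ^ n = r ^ i * r ^ (n - i)"
        by (simp flip: power_add)
      then show "\<bar>f $ i * g $ (n - i)\<bar> * r ^ n = ?a i * ?b (n - i)"
        by (simp add: abs_mult)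
    qed simp
    finally show "\<bar>(f * g) $ n\<bar> * r ^ n \<le> (\<Sum>i\<le>n. ?a i * ?b (n - i))" .
  qed
  also have "\<dots> = (\<Sum>(i, j)\<in>{(i, j). i + j \<le> N}. ?a i * ?b j)"
    by (rule sum.triangle_reindex_eq[symmetric])
  also have "\<dots> \<le> (\<Sum>(i, j)\<in>{..N} \<times> {..N}. ?a i * ?b j)"
    using assms by (intro sum_mono2) auto
  also have "\<dots> = tnorm r N f * tnorm r N g"
    by (simp add: tnorm_def sum_product sum.cartesian_product)
  finally show ?thesis .
qed

lemma tnorm_power:
  assumes "0 \<le> r"
  shows "tnorm r N (f ^ k) \<le> tnorm r N f ^ k"
proof (induction k)
  case 0
  show ?case using tnorm_const[of r N 1] by simp
next
  case (Suc k)
  have "tnorm r N (f ^ Suc k) \<le> tnorm r N f * tnorm r N (f ^ k)"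
    using tnorm_mult[OF assms] by simp
  also have "\<dots> \<le> tnorm r N f * tnorm r N f ^ k"
    using Suc tnorm_nonneg[OF assms] by (intro mult_left_mono)
  finally show ?case by simp
qed

lemma tnorm_X_mult:
  assumes "0 \<le> r"
  shows "tnorm r N (fps_X * f) \<le> r * tnorm r N f"
proof -
  have "tnorm r N fps_X = (\<Sum>n\<le>N. if n = 1 then r else 0)"
    unfolding tnorm_def by (intro sum.cong) auto
  \<comment> \<open>For \<open>N = 0\<close> the index \<open>1\<close> is cut off and the sum is
    \<open>0\<close>, hence an inequality.\<close>
  also have "\<dots> \<le> r" using assms by simp
  finally show ?thesis
    using tnorm_mult[OF assms, of N fps_X f] tnorm_nonneg[OF assms, of N f]
    by (meson mult_right_mono order_trans)
qed

lemma nth_le_tnorm: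
  assumes "0 \<le> r" "n \<le> N"
  shows "\<bar>f $ n\<bar> * r ^ n \<le> tnorm r N f"
  unfolding tnorm_def by (rule member_le_sum) (use assms in auto)

lemma tnorm_cong: "(\<And>n. n \<le> N \<Longrightarrow> f $ n = g $ n) \<Longrightarrow> tnorm r N f = tnorm r N g"
  by (simp add: tnorm_def)

text \<open>Divisibility by \<open>fps_X ^ n\<close> plays the role of the adic distance, so
  contraction can be proved by divisibility rules instead of coefficient computations.\<close>

lemma fps_X_power_dvd_iff:
  fixes f :: "'a::comm_ring_1 fps"
  shows "fps_X ^ n dvd f \<longleftrightarrow> (\<forall>j<n. f $ j = 0)"
proof
  assume "fps_X ^ n dvd f"
  then show "\<forall>j<n. f $ j = 0"
    by (auto simp: dvd_def fps_X_power_mult_nth)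
next
  assume *: "\<forall>j<n. f $ j = 0"
  have "f = fps_X ^ n * Abs_fps (\<lambda>i. f $ (i + n))"
    using * by (intro fps_ext) (auto simp: fps_X_power_mult_nth)
  then show "fps_X ^ n dvd f" by (rule dvdI)
qed

text \<open>These are the terms of degree at least two in the binomial expansion of
  \<open>(1 + v) ^ 7\<close>.\<close>

definition seventh_rem :: "'a::comm_ring_1 \<Rightarrow> 'a"
  where "seventh_rem v = 21 * v ^ 2 + 35 * v ^ 3 + 35 * v ^ 4 + 21 * v ^ 5 + 7 * v ^ 6 + v ^ 7"

lemma one_plus_power_7: "(1 + v :: 'a::comm_ring_1) ^ 7 = 1 + 7 * v + seventh_rem v"
  by (simp add: seventh_rem_def eval_nat_numeral algebra_simps)

section \<open>The fixed point map and its invariant ball\<close>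

definition with_delta :: "(int \<Rightarrow> real fps) \<Rightarrow> int \<Rightarrow> real fps"
  where "with_delta v x = fps_const (delta0 x) + v x"

text \<open>The factor is written as a constant series so that the rules for constant multiples
  apply to norms and to convergence radii.\<close>

definition fps_laplacian :: "(int \<Rightarrow> real fps) \<Rightarrow> int \<Rightarrow> real fps"
  where "fps_laplacian u x = u (x + 1) + fps_const (- 2) * u x + u (x - 1)"

text \<open>With \<open>\<psi> = delta0 + v\<close>, the equation \<open>\<psi> - \<psi>^7 = e * discrete_laplacian \<psi>\<close> reads
  \<open>- 6 * v - seventh_rem v = e * discrete_laplacian \<psi>\<close> at the origin and
  \<open>v - v^7 = e * discrete_laplacian \<psi>\<close> elsewhere; it is solved here for the linear part.\<close>

definition fp_map :: "(int \<Rightarrow> real fps) \<Rightarrow> int \<Rightarrow> real fps"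
  where "fp_map v x =
    (if x = 0 then fps_const (- 1 / 6) * (seventh_rem (v x) + fps_X * fps_laplacian (with_delta v) x)
     else v x ^ 7 + fps_X * fps_laplacian (with_delta v) x)"

lemma fp_map_fixed:
  assumes "fp_map v = v"
  shows "with_delta v x - with_delta v x ^ 7 = fps_X * fps_laplacian (with_delta v) x"
proof (cases "x = 0")
  case True
  have "v 0 = fps_const (- 1 / 6) * (seventh_rem (v 0) + fps_X * fps_laplacian (with_delta v) 0)"
    using fun_cong[OF assms, of 0] by (simp add: fp_map_def)
  \<comment> \<open>Multiplication by \<open>-6 = 1 - 7\<close> undoes the division by the linear
    part at the origin.\<close>
  then have "fps_const (- 6) * v 0 =
      fps_const (- 6) * (fps_const (- 1 / 6) * (seventh_rem (v 0) + fps_X * fps_laplacian (with_delta v) 0))"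
    by simp
  also have "\<dots> = seventh_rem (v 0) + fps_X * fps_laplacian (with_delta v) 0"
    by (simp flip: mult.assoc)
  also have "fps_const (- 6) * v 0 = - 6 * v 0"
    by (simp add: numeral_fps_const)
  finally have "- 6 * v 0 = seventh_rem (v 0) + fps_X * fps_laplacian (with_delta v) 0" .
  moreover have "with_delta v 0 = 1 + v 0"
    by (simp add: with_delta_def delta0_def)
  ultimately show ?thesis
    using True by (simp add: one_plus_power_7 algebra_simps)
next
  case False
  then show ?thesis
    using fun_cong[OF assms, of x] by (simp add: fp_map_def with_delta_def delta0_def algebra_simps)
qed

lemma decay_pos: "0 < decay x" and decay_le_1: "decay x \<le> 1" and decay_0 [simp]: "decay 0 = 1"
  by (auto simp: decay_def)

lemma decay_shift: "decay (x + 1) \<le> exp 20 * decay x" "decay (x - 1) \<le> exp 20 * decay x"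
  unfolding decay_def mult_exp_exp exp_le_cancel_iff by (auto simp: abs_if)

text \<open>The factor \<open>exp (- 20)\<close> absorbs the change of \<open>decay\<close> between neighbouring sites; the
  constant makes \<open>fp_map\<close> preserve the ball of radius \<open>1 / 1000\<close>.\<close>

definition eps_radius :: real
  where "eps_radius = exp (- 20) / 80000"

lemma eps_radius_pos: "0 < eps_radius"
  by (simp add: eps_radius_def)

lemma tnorm_with_delta:
  assumes "tnorm eps_radius N (v x) \<le> decay x / 1000"
  shows "tnorm eps_radius N (with_delta v x) \<le> 2 * decay x"
proof -
  have "tnorm eps_radius N (with_delta v x) \<le> delta0 x + decay x / 1000"
    using tnorm_add[of eps_radius N "fps_const (delta0 x)" "v x"] assms eps_radius_pos
    by (simp add: with_delta_def tnorm_const delta0_def)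
  also have "delta0 x \<le> decay x"
    using decay_pos[of x] by (auto simp: delta0_def)
  finally show ?thesis using decay_pos[of x] by simp
qed

text \<open>The three neighbouring values contribute at most
  \<open>4 * exp 20 + 4 \<le> 8 * exp 20\<close> times \<open>decay x\<close>. The factor
  \<open>fps_X\<close> contributes \<open>eps_radius\<close>, which leaves a tenth of the radius of
  the ball.\<close>

lemma tnorm_forcing:
  assumes "\<And>x. tnorm eps_radius N (v x) \<le> decay x / 1000"
  shows "tnorm eps_radius N (fps_X * fps_laplacian (with_delta v) x) \<le> decay x / 10000"
proof -
  let ?r = eps_radius
  let ?u = "with_delta v"
  have r: "0 \<le> ?r" using eps_radius_pos by simp
  have u: "tnorm ?r N (?u y) \<le> 2 * decay y" for y
    by (rule tnorm_with_delta) (rule assms)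
  have "tnorm ?r N (fps_laplacian ?u x) \<le>
      tnorm ?r N (?u (x + 1)) + 2 * tnorm ?r N (?u x) + tnorm ?r N (?u (x - 1))"
    unfolding fps_laplacian_def
    using tnorm_add[OF r, of N "?u (x + 1)" "fps_const (-2) * ?u x"]
      tnorm_add[OF r, of N "?u (x + 1) + fps_const (-2) * ?u x" "?u (x - 1)"]
      tnorm_const_mult[of ?r N "-2" "?u x"] by simp
  also have "\<dots> \<le> 2 * (exp 20 * decay x) + 2 * (2 * decay x) + 2 * (exp 20 * decay x)"
    using u[of "x + 1"] u[of x] u[of "x - 1"] decay_shift[of x] by linarith
  also have "\<dots> \<le> 8 * exp 20 * decay x"
    using decay_pos[of x] by (simp add: mult_le_cancel_right1)
  finally have "tnorm ?r N (fps_laplacian ?u x) \<le> 8 * exp 20 * decay x" .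
  then have "?r * tnorm ?r N (fps_laplacian ?u x) \<le> ?r * (8 * exp 20 * decay x)"
    using r by (rule mult_left_mono)
  also have "\<dots> = decay x / 10000"
    by (simp add: eps_radius_def exp_minus field_simps)
  finally show ?thesis
    using tnorm_X_mult[OF r, of N "fps_laplacian ?u x"] by linarith
qed

text \<open>Every power from the second on is at most a thousandth of the norm of
  \<open>v x\<close>, so the nonlinear part uses at most \<open>12 / 100\<close> of the allowed
  radius and the forcing another tenth.\<close>

lemma tnorm_fp_map:
  assumes v: "\<And>x. tnorm eps_radius N (v x) \<le> decay x / 1000"
  shows "tnorm eps_radius N (fp_map v x) \<le> decay x / 1000"
proof -
  let ?p = "tnorm eps_radius N"
  have r: "0 \<le> eps_radius" using eps_radius_pos by simp
  have p0: "0 \<le> ?p (v x)" by (rule tnorm_nonneg[OF r])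
  have forcing: "?p (fps_X * fps_laplacian (with_delta v) x) \<le> decay x / 10000"
    using v by (rule tnorm_forcing)
  have small: "?p (v x) \<le> 1 / 1000"
    using v[of x] decay_le_1[of x] by simp
  have pow: "?p (v x ^ k) \<le> ?p (v x) / 1000" if "2 \<le> k" for k
  proof -
    have "?p (v x ^ k) \<le> ?p (v x) ^ k" by (rule tnorm_power[OF r])
    also have "\<dots> \<le> ?p (v x) ^ 2"
      using that small p0 by (intro power_decreasing) auto
    also have "\<dots> \<le> ?p (v x) / 1000"
      using mult_left_mono[OF small p0] by (simp add: power2_eq_square)
    finally show ?thesis .
  qed
  show ?thesis
  proof (cases "x = 0")
    case True
    have "?p (seventh_rem (v x)) \<le> 21 * ?p (v x ^ 2) + 35 * ?p (v x ^ 3) + 35 * ?p (v x ^ 4)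
        + 21 * ?p (v x ^ 5) + 7 * ?p (v x ^ 6) + ?p (v x ^ 7)"
      unfolding seventh_rem_def tnorm_numeral_mult[symmetric]
      by (intro order_trans[OF tnorm_add[OF r]] add_right_mono order_refl)
    \<comment> \<open>The coefficients sum to \<open>120 = 2 ^ 7 - 1 - 7\<close>.\<close>
    also have "\<dots> \<le> 120 * (?p (v x) / 1000)"
      using pow[of 2] pow[of 3] pow[of 4] pow[of 5] pow[of 6] pow[of 7] by simp
    finally have "?p (seventh_rem (v x)) \<le> 120 * (?p (v x) / 1000)" .
    with forcing v[of x] tnorm_add[OF r, of N "seventh_rem (v x)" "fps_X * fps_laplacian (with_delta v) x"]
    show ?thesis
      using True decay_pos[of x] by (simp add: fp_map_def tnorm_const_mult)
  next
    case False
    with forcing v[of x] pow[of 7] tnorm_add[OF r, of N "v x ^ 7" "fps_X * fps_laplacian (with_delta v) x"]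
    show ?thesis
      using decay_pos[of x] by (simp add: fp_map_def)
  qed
qed

text \<open>After factoring out \<open>v - w\<close>, every remaining summand has total degree
  \<open>k - 1 \<ge> 1\<close> in \<open>v\<close> and \<open>w\<close>, and so supplies the
  additional factor \<open>fps_X\<close>.\<close>

lemma fps_X_power_dvd_power_diff:
  fixes v w :: "'a::comm_ring_1 fps"
  assumes "fps_X dvd v" "fps_X dvd w" "fps_X ^ n dvd v - w" "2 \<le> k"
  shows "fps_X ^ Suc n dvd v ^ k - w ^ k"
proof -
  obtain m where m: "k = Suc (Suc m)"
    using \<open>2 \<le> k\<close> by (metis Suc_le_D numeral_2_eq_2 Suc_le_mono)
  have "v ^ Suc (Suc m) - w ^ Suc (Suc m) = (v - w) * (\<Sum>i<Suc (Suc m). v ^ i * w ^ (Suc m - i))"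
    by (simp add: diff_power_eq_sum del: power_Suc)
  moreover have "fps_X dvd (\<Sum>i<Suc (Suc m). v ^ i * w ^ (Suc m - i))"
  proof (rule dvd_sum)
    fix i assume "i \<in> {..<Suc (Suc m)}"
    show "fps_X dvd v ^ i * w ^ (Suc m - i)"
    proof (cases i)
      case 0
      then show ?thesis using assms(2) by simp
    next
      case (Suc j)
      then show ?thesis using assms(1) by simp
    qed
  qed
  ultimately show ?thesis
    unfolding m power_Suc2[of fps_X] using assms(3) by (simp only: mult_dvd_mono)
qed

text \<open>Every term contains \<open>v x\<close> or an explicit \<open>fps_X\<close>, so the
  vanishing of constant terms, on which the contraction rests, persists under iteration.\<close>

lemma fps_X_dvd_fp_map:
  assumes "\<And>x. fps_X dvd v x"
  shows "fps_X dvd fp_map v x"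
proof -
  have "fps_X dvd f \<longleftrightarrow> f $ 0 = 0" for f :: "real fps"
    using fps_X_power_dvd_iff[of 1 f] by simp
  then show ?thesis
    using assms by (simp add: fp_map_def seventh_rem_def fps_mult_nth_0 fps_power_zeroth)
qed

text \<open>This is the adic contraction: the nonlinear terms gain an order because they are at
  least quadratic, the Laplacian because it is multiplied by \<open>fps_X\<close>.\<close>

lemma fps_X_power_dvd_fp_map_diff:
  assumes v: "\<And>x. fps_X dvd v x" and w: "\<And>x. fps_X dvd w x"
    and vw: "\<And>x. fps_X ^ n dvd v x - w x"
  shows "fps_X ^ Suc n dvd fp_map v x - fp_map w x"
proof -
  have pow: "fps_X ^ Suc n dvd v x ^ k - w x ^ k" if "2 \<le> k" for k
    using fps_X_power_dvd_power_diff[OF v w vw that] .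
  have "fps_laplacian (with_delta v) x - fps_laplacian (with_delta w) x =
      (v (x + 1) - w (x + 1)) + fps_const (- 2) * (v x - w x) + (v (x - 1) - w (x - 1))"
    by (simp add: fps_laplacian_def with_delta_def algebra_simps)
  moreover have "fps_X ^ n dvd \<dots>"
    by (intro dvd_add dvd_mult vw)
  ultimately have "fps_X ^ n dvd fps_laplacian (with_delta v) x - fps_laplacian (with_delta w) x"
    by (simp only:)
  then have lap: "fps_X ^ Suc n dvd
      fps_X * (fps_laplacian (with_delta v) x - fps_laplacian (with_delta w) x)"
    by (simp add: mult_dvd_mono)
  have rem: "fps_X ^ Suc n dvd seventh_rem (v x) - seventh_rem (w x)"
  proof -
    have "seventh_rem (v x) - seventh_rem (w x) = 21 * (v x ^ 2 - w x ^ 2) + 35 * (v x ^ 3 - w x ^ 3)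
        + 35 * (v x ^ 4 - w x ^ 4) + 21 * (v x ^ 5 - w x ^ 5) + 7 * (v x ^ 6 - w x ^ 6)
        + (v x ^ 7 - w x ^ 7)"
      by (simp add: seventh_rem_def algebra_simps)
    moreover have "fps_X ^ Suc n dvd \<dots>"
      by (intro dvd_add dvd_mult pow) simp_all
    ultimately show ?thesis by (simp only:)
  qed
  show ?thesis
  proof (cases "x = 0")
    case True
    then have "fp_map v x - fp_map w x = fps_const (- 1 / 6) * ((seventh_rem (v x) - seventh_rem (w x))
        + fps_X * (fps_laplacian (with_delta v) x - fps_laplacian (with_delta w) x))"
      by (simp add: fp_map_def algebra_simps)
    moreover have "fps_X ^ Suc n dvd \<dots>"
      by (intro dvd_add dvd_mult[of _ _ "fps_const _"] lap rem)
    ultimately show ?thesis by (simp only:)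
  next
    case False
    then have "fp_map v x - fp_map w x = (v x ^ 7 - w x ^ 7)
        + fps_X * (fps_laplacian (with_delta v) x - fps_laplacian (with_delta w) x)"
      by (simp add: fp_map_def algebra_simps)
    moreover have "fps_X ^ Suc n dvd \<dots>"
      by (intro dvd_add lap pow) simp
    ultimately show ?thesis by (simp only:)
  qed
qed

section \<open>The fixed point as adic limit of the iterates\<close>

definition iterate :: "nat \<Rightarrow> int \<Rightarrow> real fps"
  where "iterate k = (fp_map ^^ k) (\<lambda>x. 0)"

lemma iterate_Suc: "iterate (Suc k) = fp_map (iterate k)"
  by (simp add: iterate_def)

lemma fps_X_dvd_iterate: "fps_X dvd iterate k x"
proof (induction k arbitrary: x)
  case 0
  then show ?case by (simp add: iterate_def)
next
  case (Suc k)
  then show ?case unfolding iterate_Suc by (rule fps_X_dvd_fp_map)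
qed

lemma tnorm_iterate: "tnorm eps_radius N (iterate k x) \<le> decay x / 1000"
proof (induction k arbitrary: x)
  case 0
  then show ?case using decay_pos[of x] by (simp add: iterate_def)
next
  case (Suc k)
  then show ?case unfolding iterate_Suc by (rule tnorm_fp_map)
qed

text \<open>The first iterate has no constant term and the zeroth is zero, so they agree to order
  one; each application of the map gains one more order.\<close>

lemma iterate_step: "fps_X ^ Suc k dvd iterate (Suc k) x - iterate k x"
proof (induction k arbitrary: x)
  case 0
  show ?case using fps_X_dvd_iterate[of 1 x] by (simp add: iterate_def)
next
  case (Suc k)
  show ?case
    using fps_X_power_dvd_fp_map_diff[of "iterate (Suc k)" "iterate k", OF fps_X_dvd_iterate fps_X_dvd_iterate Suc]
    unfolding iterate_Suc .
qed

lemma iterate_nth_stable: "n \<le> k \<Longrightarrow> iterate k x $ n = iterate n x $ n"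
proof (induction k rule: dec_induct)
  case (step m)
  then have "(iterate (Suc m) x - iterate m x) $ n = 0"
    using iterate_step[of m x] unfolding fps_X_power_dvd_iff by simp
  then show ?case using step by simp
qed simp

text \<open>The diagonal is the adic limit: the coefficient of index \<open>n\<close> is final from
  iterate \<open>n\<close> on.\<close>

definition profile :: "int \<Rightarrow> real fps"
  where "profile x = Abs_fps (\<lambda>n. iterate n x $ n)"

lemma profile_iterate: "fps_X ^ Suc n dvd profile x - iterate n x"
  unfolding fps_X_power_dvd_iff
  by (auto simp: profile_def less_Suc_eq_le intro: iterate_nth_stable[symmetric])

lemma fps_X_dvd_profile: "fps_X dvd profile x"
  using profile_iterate[of 0 x] by (simp add: iterate_def)

text \<open>By contraction, both sides agree with iterate \<open>n + 1\<close> through order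
  \<open>n + 1\<close>, for every \<open>n\<close>.\<close>

lemma fp_map_profile: "fp_map profile = profile"
proof
  fix x
  show "fp_map profile x = profile x"
  proof (rule fps_ext)
    fix n
    have "fps_X ^ Suc (Suc n) dvd fp_map profile x - iterate (Suc n) x"
      unfolding iterate_Suc
      by (rule fps_X_power_dvd_fp_map_diff[OF fps_X_dvd_profile fps_X_dvd_iterate profile_iterate])
    moreover have "fps_X ^ Suc (Suc n) dvd profile x - iterate (Suc n) x"
      by (rule profile_iterate)
    ultimately show "fp_map profile x $ n = profile x $ n"
      unfolding fps_X_power_dvd_iff by simp
  qed
qed

text \<open>The norm truncated at \<open>N\<close> cannot distinguish the limit from iterate
  \<open>N\<close>, so the invariant ball contains the limit.\<close>

lemma tnorm_profile: "tnorm eps_radius N (profile x) \<le> decay x / 1000"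
proof -
  have "tnorm eps_radius N (profile x) = tnorm eps_radius N (iterate N x)"
    by (rule tnorm_cong) (auto simp: profile_def intro: iterate_nth_stable[symmetric])
  then show ?thesis using tnorm_iterate by simp
qed

section \<open>Convergence of the formal solution\<close>

definition profile_coeff :: "nat \<Rightarrow> int \<Rightarrow> real"
  where "profile_coeff n x = with_delta profile x $ n"

lemma profile_coeff_0: "profile_coeff 0 x = delta0 x"
  using fps_X_dvd_profile[of x] fps_X_power_dvd_iff[of 1 "profile x"]
  by (simp add: profile_coeff_def with_delta_def)

text \<open>The term of index \<open>n\<close> is bounded by the norm truncated at
  \<open>N = n\<close>; uniformity in \<open>N\<close> thus becomes geometric growth.\<close>

lemma abs_profile_coeff_le: "\<bar>profile_coeff n x\<bar> \<le> 2 * (1 / eps_radius) ^ n * decay x"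
proof -
  have "\<bar>profile_coeff n x\<bar> * eps_radius ^ n \<le> 2 * decay x"
    using nth_le_tnorm[of eps_radius n n "with_delta profile x"] tnorm_with_delta[of n profile x, OF tnorm_profile]
      eps_radius_pos by (simp add: profile_coeff_def)
  then show ?thesis
    using eps_radius_pos by (simp add: field_simps power_divide)
qed

text \<open>The coefficient bounds give convergence radius at least \<open>eps_radius\<close> at
  every site; there, evaluation respects sums and products and turns the formal identity into a
  numerical one.\<close>

lemma profile_series:
  assumes e: "\<bar>e\<bar> < eps_radius"
  defines "\<psi> \<equiv> \<lambda>x. \<Sum>n. profile_coeff n x * e ^ n"
  shows "(\<lambda>n. profile_coeff n x * e ^ n) sums \<psi> x"
    and "\<psi> x - \<psi> x ^ 7 = e * (\<psi> (x + 1) - 2 * \<psi> x + \<psi> (x - 1))"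
proof -
  let ?u = "with_delta profile"
  have \<psi>: "\<psi> = (\<lambda>x. eval_fps (?u x) e)"
    by (simp add: \<psi>_def eval_fps_def profile_coeff_def)
  have "eps_radius \<le> fps_conv_radius (?u x)" for x
    unfolding fps_conv_radius_def
  proof (rule conv_radius_geI_ex')
    fix r assume r: "0 < r" "ereal r < ereal eps_radius"
    have "summable (\<lambda>n. 2 * decay x * (r / eps_radius) ^ n)"
      using r by (intro summable_mult summable_geometric) auto
    then show "summable (\<lambda>n. ?u x $ n * of_real r ^ n)"
    proof (rule summable_comparison_test'[where N = 0])
      fix n
      have "\<bar>profile_coeff n x\<bar> * r ^ n \<le> 2 * (1 / eps_radius) ^ n * decay x * r ^ n"
        using abs_profile_coeff_le[of n x] r by (intro mult_right_mono) auto
      also have "\<dots> = 2 * decay x * (r / eps_radius) ^ n"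
        by (simp add: power_divide)
      finally show "norm (?u x $ n * of_real r ^ n) \<le> 2 * decay x * (r / eps_radius) ^ n"
        using r by (simp add: profile_coeff_def abs_mult)
    qed
  qed
  then have rad: "norm e < fps_conv_radius (?u x)" for x
    using e by (metis ereal_less_eq(3) less_le_trans less_ereal.simps(1) real_norm_def)
  show "(\<lambda>n. profile_coeff n x * e ^ n) sums \<psi> x"
    unfolding \<psi> profile_coeff_def by (rule sums_eval_fps[OF rad])
  have c: "norm e < fps_conv_radius (fps_const a * ?u x)" for a x
    using rad fps_conv_radius_cmult_left[of a "?u x"] by (cases "a = 0") auto
  have s1: "norm e < fps_conv_radius (?u (x + 1) + fps_const (- 2) * ?u x)"
    using rad[of "x + 1"] c[of "-2" x] fps_conv_radius_add[of "?u (x + 1)" "fps_const (- 2) * ?u x"]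
    by (meson less_le_trans min_less_iff_conj)
  have s2: "norm e < fps_conv_radius (fps_laplacian ?u x)"
    using s1 rad[of "x - 1"]
      fps_conv_radius_add[of "?u (x + 1) + fps_const (- 2) * ?u x" "?u (x - 1)"]
    unfolding fps_laplacian_def by (meson less_le_trans min_less_iff_conj)
  have p: "norm e < fps_conv_radius (?u x ^ 7)"
    using rad[of x] fps_conv_radius_power[of "?u x" 7] by (meson less_le_trans)
  have "eval_fps (?u x - ?u x ^ 7) e = \<psi> x - \<psi> x ^ 7"
    using rad p by (simp add: eval_fps_diff eval_fps_power \<psi>)
  moreover have "eval_fps (fps_X * fps_laplacian ?u x) e = e * (\<psi> (x + 1) - 2 * \<psi> x + \<psi> (x - 1))"
    using rad c s1 s2 by (simp add: eval_fps_mult fps_laplacian_def eval_fps_add \<psi>)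
  ultimately show "\<psi> x - \<psi> x ^ 7 = e * (\<psi> (x + 1) - 2 * \<psi> x + \<psi> (x - 1))"
    using fp_map_fixed[OF fp_map_profile, of x] by simp
qed

section \<open>The bound state\<close>

lift_definition l2_coeff :: "nat \<Rightarrow> l2_10" is "\<lambda>n x. complex_of_real (profile_coeff n x)"
  by (rule weighted_l2_decay(1)[where M = "2 * (1 / eps_radius) ^ n" for n])
    (use abs_profile_coeff_le eps_radius_pos in auto)

lemma norm_l2_coeff_le:
  "norm (l2_coeff n) \<le> 2 * sqrt (infsum decay UNIV) * (1 / eps_radius) ^ n"
proof -
  have "norm (l2_coeff n) \<le> 2 * (1 / eps_radius) ^ n * sqrt (infsum decay UNIV)"
    unfolding norm_l2_10.rep_eq l2_coeff.rep_eq
    by (rule weighted_l2_decay(2)) (use abs_profile_coeff_le eps_radius_pos in auto)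
  then show ?thesis by (simp add: mult_ac)
qed

lemma l2_coeff_0: "l2_coeff 0 = delta0_l2"
  by transfer (simp add: profile_coeff_0)

text \<open>At each site the value is the real number \<open>A * \<psi> x\<close> with
  \<open>A = \<omega> powr (1/6)\<close>, and the equation is that of \<open>\<psi>\<close> at
  \<open>e = 1 / \<omega>\<close> multiplied by \<open>A * \<omega>\<close>.\<close>

lemma desc_series_solves:
  assumes w: "1 / eps_radius < \<omega>"
  defines "u \<equiv> l2_10_apply (desc_series (1/6) l2_coeff \<omega>)"
  shows "0 = - discrete_laplacian u x + complex_of_real \<omega> * u x - complex_of_real (cmod (u x) ^ 6) * u x"
proof -
  have w0: "0 < \<omega>" using w eps_radius_pos by (meson less_trans zero_less_divide_1_iff)
  define e where "e = 1 / \<omega>"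
  have e: "\<bar>e\<bar> < eps_radius"
    using w w0 eps_radius_pos by (simp add: e_def field_simps)
  define \<psi> where "\<psi> x = (\<Sum>n. profile_coeff n x * e ^ n)" for x
  note series = profile_series[OF e, folded \<psi>_def]
  define A where "A = \<omega> powr (1/6)"
  have A: "A ^ 6 = \<omega>"
    using w0 by (simp add: A_def powr_power)
  have u: "u x = complex_of_real (A * \<psi> x)" for x
  proof -
    have "(\<lambda>n. l2_10_apply (\<omega> powr (1/6 - real n) *\<^sub>R l2_coeff n) x) sums u x"
      unfolding u_def
      by (rule bounded_linear.sums[OF bounded_linear_l2_10_apply desc_series_sums[OF norm_l2_coeff_le _ w]])
        (use eps_radius_pos in simp)
    moreover have "l2_10_apply (\<omega> powr (1/6 - real n) *\<^sub>R l2_coeff n) x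
        = complex_of_real (A * (profile_coeff n x * e ^ n))" for n
      using powr_diff_nat[OF w0, of "1/6" n]
      by (simp add: scaleR_l2_10.rep_eq l2_coeff.rep_eq scaleR_conv_of_real A_def e_def mult_ac)
    ultimately have "(\<lambda>n. complex_of_real (A * (profile_coeff n x * e ^ n))) sums u x"
      by simp
    moreover have "(\<lambda>n. complex_of_real (A * (profile_coeff n x * e ^ n))) sums complex_of_real (A * \<psi> x)"
      by (intro sums_of_real sums_mult series)
    ultimately show ?thesis by (rule sums_unique2)
  qed
  have "\<omega> * (\<psi> x - \<psi> x ^ 7) = \<psi> (x + 1) - 2 * \<psi> x + \<psi> (x - 1)"
    unfolding series(2) using w0 by (simp add: e_def)
  then have "A * (\<omega> * (\<psi> x - \<psi> x ^ 7)) = A * (\<psi> (x + 1) - 2 * \<psi> x + \<psi> (x - 1))"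
    by simp
  \<comment> \<open>Since \<open>A ^ 7 = A * \<omega>\<close>, the septic term scales like the
    linear one; this fixes the exponent \<open>1/6\<close>.\<close>
  moreover have "\<bar>A * \<psi> x\<bar> ^ 6 * (A * \<psi> x) = A * (\<omega> * \<psi> x ^ 7)"
    unfolding A[symmetric] by (simp add: power_mult_distrib power_even_abs eval_nat_numeral)
  ultimately have "0 = - (A * \<psi> (x + 1) - 2 * (A * \<psi> x) + A * \<psi> (x - 1)) + \<omega> * (A * \<psi> x)
      - \<bar>A * \<psi> x\<bar> ^ 6 * (A * \<psi> x)"
    by (simp add: algebra_simps)
  then have "complex_of_real 0 = complex_of_real (- (A * \<psi> (x + 1) - 2 * (A * \<psi> x) + A * \<psi> (x - 1))
      + \<omega> * (A * \<psi> x) - \<bar>A * \<psi> x\<bar> ^ 6 * (A * \<psi> x))"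
    by (rule arg_cong)
  moreover have "cmod (u x) = \<bar>A * \<psi> x\<bar>"
    by (simp only: u norm_of_real)
  ultimately show ?thesis
    by (simp add: discrete_laplacian_def u)
qed

lemma real_analytic_on_subset: "real_analytic_on f T \<Longrightarrow> S \<subseteq> T \<Longrightarrow> real_analytic_on f S"
  by (auto simp: real_analytic_on_def)

theorem proposition1p2:
  shows "\<exists>\<omega>\<^sub>0>0. \<exists>C>0. \<exists>\<phi> :: real \<Rightarrow> l2_10.
    real_analytic_on \<phi> {\<omega>\<^sub>0<..} \<and>
    (\<forall>\<omega>>\<omega>\<^sub>0.
      (\<forall>x. 0 = - discrete_laplacian (l2_10_apply (\<phi> \<omega>)) x
               + complex_of_real \<omega> * l2_10_apply (\<phi> \<omega>) x
               - complex_of_real (cmod (l2_10_apply (\<phi> \<omega>) x) ^ 6) * l2_10_apply (\<phi> \<omega>) x) \<and>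
      (\<Sum>j=0..2. \<omega> ^ j * norm (higher_vector_derivative j \<phi> \<omega>
          - higher_vector_derivative j (\<lambda>t. (t powr (1/6)) *\<^sub>R delta0_l2) \<omega>))
        \<le> C * \<omega> powr (-5/6) \<and>
      (\<Sum>j=0..2. \<omega> ^ j * norm (P0_perp_l2 (higher_vector_derivative j \<phi> \<omega>)))
        \<le> C * \<omega> powr (-5/6))"
proof -
  let ?\<phi> = "desc_series (1/6) l2_coeff"
  let ?D = "1 / eps_radius" and ?K = "2 * sqrt (infsum decay UNIV)"
  \<comment> \<open>\<open>B j\<close> is the constant of
    \<open>norm_higher_vector_derivative_diff\<close> at order \<open>j\<close>; the summand
    \<open>1\<close> in \<open>C\<close> ensures positivity.\<close>
  define B where "B j = 2 * (?K * (\<Prod>i<j. \<bar>1/6 - real i\<bar> + 1)) * (2 ^ j * ?D)" for j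
  define C where "C = 1 + (\<Sum>j=0..2. B j)"
  have D: "0 < ?D" using eps_radius_pos by simp
  have K: "0 \<le> ?K" by (simp add: infsum_nonneg decay_def)
  have B: "0 \<le> B j" for j
    unfolding B_def using K eps_radius_pos by (intro mult_nonneg_nonneg prod_nonneg) auto
  have C: "0 < C" using sum_nonneg[of "{0..2}" B] B by (simp add: C_def add_pos_nonneg)
  have diff: "\<omega> ^ j * norm (higher_vector_derivative j ?\<phi> \<omega>
      - higher_vector_derivative j (\<lambda>t. (t powr (1/6)) *\<^sub>R delta0_l2) \<omega>) \<le> B j * \<omega> powr (-5/6)"
    if w: "8 * ?D < \<omega>" and j: "j \<in> {0..2}" for \<omega> j
  proof -
    have w0: "0 < \<omega>" using w D by linarith
    \<comment> \<open>Order \<open>j\<close> needs the threshold \<open>2 ^ (j + 1) * ?D\<close>, so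
      \<open>8\<close> covers all orders up to two.\<close>
    have "(2::real) ^ Suc j \<le> 2 ^ 3" using j by (intro power_increasing) auto
    then have "2 ^ Suc j * ?D \<le> 2 ^ 3 * ?D" using D by (intro mult_right_mono) auto
    then have "2 ^ Suc j * ?D \<le> \<omega>" using w by simp
    from norm_higher_vector_derivative_diff[OF norm_l2_coeff_le D this, of "1/6"]
    have "norm (higher_vector_derivative j ?\<phi> \<omega>
        - higher_vector_derivative j (\<lambda>t. (t powr (1/6)) *\<^sub>R delta0_l2) \<omega>)
        \<le> B j * \<omega> powr (1/6 - real j - 1)"
      by (simp only: B_def l2_coeff_0)
    then have "\<omega> ^ j * norm (higher_vector_derivative j ?\<phi> \<omega>
        - higher_vector_derivative j (\<lambda>t. (t powr (1/6)) *\<^sub>R delta0_l2) \<omega>)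
        \<le> \<omega> ^ j * (B j * \<omega> powr (1/6 - real j - 1))"
      using w0 by (intro mult_left_mono) auto
    also have "\<dots> = B j * (\<omega> powr real j * \<omega> powr (1/6 - real j - 1))"
      using w0 by (simp add: powr_realpow)
    also have "\<dots> = B j * \<omega> powr (-5/6)"
      unfolding powr_add[symmetric] by simp
    finally show ?thesis .
  qed
  \<comment> \<open>All derivatives of the leading term are multiples of \<open>delta0_l2\<close>,
    which the projection kills. The third estimate therefore reduces to the second.\<close>
  have P0: "norm (P0_perp_l2 (higher_vector_derivative j ?\<phi> \<omega>)) \<le>
      norm (higher_vector_derivative j ?\<phi> \<omega>
        - higher_vector_derivative j (\<lambda>t. (t powr (1/6)) *\<^sub>R delta0_l2) \<omega>)"
    if "0 < \<omega>" for \<omega> j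
  proof -
    interpret bounded_linear P0_perp_l2 by (rule bounded_linear_P0_perp_l2)
    have "P0_perp_l2 (higher_vector_derivative j (\<lambda>t. (t powr (1/6)) *\<^sub>R delta0_l2) \<omega>) = 0"
      by (simp add: higher_vector_derivative_powr[OF that] scaleR P0_perp_delta0)
    then show ?thesis
      using norm_P0_perp_l2_le by (metis diff diff_zero)
  qed
  have total: "(\<Sum>j=0..2. f j) \<le> C * \<omega> powr (-5/6)"
    if "\<And>j. j \<in> {0..2} \<Longrightarrow> f j \<le> B j * \<omega> powr (-5/6)" for f \<omega>
  proof -
    have "(\<Sum>j=0..2. f j) \<le> (\<Sum>j=0..2. B j * \<omega> powr (-5/6))"
      using that by (rule sum_mono)
    also have "\<dots> \<le> C * \<omega> powr (-5/6)"
      unfolding sum_distrib_right[symmetric] C_def by (intro mult_right_mono) auto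
    finally show ?thesis .
  qed
  show ?thesis
  proof (intro exI conjI allI impI)
    show "0 < 8 * ?D" using D by simp
    show "0 < C" by (rule C)
    show "real_analytic_on ?\<phi> {8 * ?D<..}"
      by (rule real_analytic_on_subset[OF real_analytic_on_desc_series[OF norm_l2_coeff_le D]])
        (use D in \<open>auto intro!: divide_right_mono\<close>)
    fix \<omega> assume w: "8 * ?D < \<omega>"
    have w1: "?D < \<omega>" "0 < \<omega>" using w D by linarith+
    show "0 = - discrete_laplacian (l2_10_apply (?\<phi> \<omega>)) x
               + complex_of_real \<omega> * l2_10_apply (?\<phi> \<omega>) x
               - complex_of_real (cmod (l2_10_apply (?\<phi> \<omega>) x) ^ 6) * l2_10_apply (?\<phi> \<omega>) x" for x
      by (rule desc_series_solves[OF w1(1)])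
    show "(\<Sum>j=0..2. \<omega> ^ j * norm (higher_vector_derivative j ?\<phi> \<omega>
          - higher_vector_derivative j (\<lambda>t. (t powr (1/6)) *\<^sub>R delta0_l2) \<omega>))
        \<le> C * \<omega> powr (-5/6)"
      by (rule total) (rule diff[OF w])
    show "(\<Sum>j=0..2. \<omega> ^ j * norm (P0_perp_l2 (higher_vector_derivative j ?\<phi> \<omega>)))
        \<le> C * \<omega> powr (-5/6)"
    proof (rule total)
      fix j :: nat assume "j \<in> {0..2}"
      from order_trans[OF mult_left_mono[OF P0[OF w1(2)]] diff[OF w this]] w1(2)
      show "\<omega> ^ j * norm (P0_perp_l2 (higher_vector_derivative j ?\<phi> \<omega>)) \<le> B j * \<omega> powr (-5/6)"
        by simp
    qed
  qed
qed

end
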